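(* There is a constant $M$ depending only on $d_y,d_r,\underline d$ (and not on $m$, $T$, the sets $Z_t$, $\Psi$ or the partition) such that the following holds. Suppose the step sizes are $\eta_t=\min\{\frac1m,\frac1{\sqrt{mt}}\}$ for all $t=1,\dots,T$. Under the grouped random permutation model with groups $(\mathcal T_k)_{k=1}^K$, the primal-dual algorithm satisfies $$\mathbb E_\pi\Big[\sum_{t=1}^T r_t\Big]\ge z_R-M\Big(W+\sqrt{m\log m}\sum_{k=1}^K\sqrt{|\mathcal T_k|}\Big),$$ where $W$ is the unevenness measure of the partition $(\mathcal T_k)_{k=1}^K$ and $\log m$ is read as $\max\{1,\log m\}$.
   Context: Setting. $T,m\ge 1$ are integers and $\mathcal T=\{1,\dots,T\}$. $\Psi\subseteq\mathbb R^m$ is a closed convex set that is Motzkin decomposable: $\Psi=Q+C$ with $Q$ a nonempty compact convex set and $C$ a closed convex cone (the recession cone of $\Psi$). $C^\circ=\{p\in\mathbb R^m:p^\top c\le 0\ \forall c\in C\}$ is the polar cone of $C$, and $\mathrm{proj}_{C^\circ}$ is Euclidean projection. Grouped random permutation model. $\mathcal T$ is partitioned into $K$ disjoint nonempty groups $\mathcal T_1,\dots,\mathcal T_K$. $Z_1,\dots,Z_T$ are fixed deterministic nonempty compact (possibly non-convex) sets of decisions $(r,x,y)$ with $r\in\mathbb R$ (reward), $x$ in some finite-dimensional real space, $y\in\mathbb R^m$ (fairness impact). The local feasible set at time $t$ is $\Omega_t=Z_{\pi(t)}$, where $\pi$ is a random permutation of $\mathcal T$ that maps each $\mathcal T_k$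 onto itself, its restriction to each $\mathcal T_k$ being a uniformly random permutation of $\mathcal T_k$, independently across $k$. $\mathbb E_\pi$ denotes expectation over $\pi$. The algorithm does not know the groups or $\pi$. Unevenness measure. For $i,j\in\mathcal T$ let $d_{ij}=\sum_{t=i}^{j-1}\eta_t$ if $i<j$, $d_{ij}=\sum_{t=j}^{i-1}\eta_t$ if $i>j$, and $d_{ii}=0$. For each $k$ let $w_k$ be the Wasserstein distance between the uniform distributions on $\mathcal T$ and on $\mathcal T_k$: $$w_k=\min_{q\in\mathbb R_+^{\mathcal T_k\times\mathcal T}}\Big\{\sum_{i\in\mathcal T_k}\sum_{j\in\mathcal T}d_{ij}q_{ij}:\ \sum_{i\in\mathcal T_k}q_{ij}=\tfrac1T\ \forall j\in\mathcal T,\ \ \sum_{j\in\mathcal T}q_{ij}=\tfrac1{|\mathcal T_k|}\ \forall i\in\mathcal T_k\Big\}.$$ The unevenness measure is $W=\sum_{k=1}^K m|\mathcal T_k|w_k$. Benchmark. $z_R=\max\{\sum_{t=1}^T r_t:(r_t,x_t,y_t)\in\mathrm{conv}(\Omega_t),\ t=1,\dots,T,\ \sum_{t=1}^T y_t\in T\Psi\}$, assumed feasible; its value does not depend on $\pi$. Regularity assumptions. There are constants $d_y,d_r,\underline d>0$ with $d_y=O(1)$, $d_r=O(1)$, $\underline d=\Omega(1)$ such that for every local feasible set $\Omega_t$ (equivalently every $Z_t$): (1) $\max_{v\in Q}\|y-v\|_\infty\le d_y$ for every $(r,x,y)\in\Omega_t$; (2) there is $(\tilde r_t,\tilde x_t,\tilde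 y_t)\in\mathrm{conv}(\Omega_t)$ with $\tilde r_t\ge\max_{(r,x,y)\in\Omega_t}r-d_r$ and $\{\tilde y_t\}+\underline dB_m\subseteq\Psi$, where $B_m$ is the unit Euclidean ball of $\mathbb R^m$. Primal-dual algorithm. Set $p_1=\mathbf 0$. For $t=1,\dots,T$: after observing $\Omega_t$, choose $(r_t,x_t,y_t)\in\arg\max\{r-p_t^\top y:(r,x,y)\in\Omega_t\}$; choose $v_t\in\arg\max_{v\in Q}p_t^\top v$ (any such $v_t$ also maximizes $p_t^\top v$ over $\Psi$ since $p_t\in C^\circ$); set $p_{t+1}=\mathrm{proj}_{C^\circ}(p_t-\eta_t(v_t-y_t))$. The algorithm is online: the choices at time $t$ (including tie-breaking) are determined by $\Omega_1,\dots,\Omega_t$ only. *)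

theory Defs
  imports "HOL-Analysis.Analysis" "HOL-Probability.Probability" "HOL-Combinatorics.Permutations"
begin

(* The constant in the theorem must be chosen before the dimension m, so R^m cannot be a type
   "real ^ 'm".  All R^m live inside one inner product space: the finitely supported real
   sequences with the l2 inner product; R^m is the subspace of sequences supported on
   {0,...,m-1}.  On each R^m the inherited norm and topology are the Euclidean ones. *)

typedef fsvec = "{f :: nat \<Rightarrow> real. finite {i. f i \<noteq> 0}}"
  morphisms coord Abs_fsvec
  by (rule exI[of _ "\<lambda>_. 0"]) simp

definition supp :: "fsvec \<Rightarrow> nat set" where
  "supp x = {i. coord x i \<noteq> 0}"

lemma finite_supp [simp]: "finite (supp x)"
  using coord[of x] by (simp add: supp_def)

lemma fsvec_eqI: "(\<And>i. coord x i = coord y i) \<Longrightarrow> x = y"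
  by (simp add: coord_inject[symmetric] fun_eq_iff)

lemma coord_Abs_fsvec: "finite {i. f i \<noteq> 0} \<Longrightarrow> coord (Abs_fsvec f) i = f i"
  by (simp add: Abs_fsvec_inverse)

instantiation fsvec :: real_inner
begin

definition zero_fsvec :: fsvec where
  "0 = Abs_fsvec (\<lambda>_. 0)"

definition plus_fsvec :: "fsvec \<Rightarrow> fsvec \<Rightarrow> fsvec" where
  "x + y = Abs_fsvec (\<lambda>i. coord x i + coord y i)"

definition minus_fsvec :: "fsvec \<Rightarrow> fsvec \<Rightarrow> fsvec" where
  "x - y = Abs_fsvec (\<lambda>i. coord x i - coord y i)"

definition uminus_fsvec :: "fsvec \<Rightarrow> fsvec" where
  "- x = Abs_fsvec (\<lambda>i. - coord x i)"

definition scaleR_fsvec :: "real \<Rightarrow> fsvec \<Rightarrow> fsvec" where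
  "c *\<^sub>R x = Abs_fsvec (\<lambda>i. c * coord x i)"

definition inner_fsvec :: "fsvec \<Rightarrow> fsvec \<Rightarrow> real" where
  "x \<bullet> y = (\<Sum>i\<in>supp x \<inter> supp y. coord x i * coord y i)"

definition norm_fsvec :: "fsvec \<Rightarrow> real" where
  "norm (x :: fsvec) = sqrt (x \<bullet> x)"

definition sgn_fsvec :: "fsvec \<Rightarrow> fsvec" where
  "sgn (x :: fsvec) = inverse (norm x) *\<^sub>R x"

definition dist_fsvec :: "fsvec \<Rightarrow> fsvec \<Rightarrow> real" where
  "dist (x :: fsvec) y = norm (x - y)"

definition uniformity_fsvec :: "(fsvec \<times> fsvec) filter" where
  "uniformity = (INF e\<in>{0<..}. principal {(x :: fsvec, y). dist x y < e})"

definition open_fsvec :: "fsvec set \<Rightarrow> bool" where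
  "open U \<longleftrightarrow> (\<forall>x\<in>U. \<forall>\<^sub>F (x', y) in uniformity. x' = x \<longrightarrow> y \<in> (U :: fsvec set))"

lemma coord_zero: "coord 0 i = 0"
  by (simp add: zero_fsvec_def coord_Abs_fsvec)

lemma coord_plus: "coord (x + y) i = coord x i + coord y i"
proof -
  have "finite {i. coord x i + coord y i \<noteq> 0}"
    by (rule finite_subset[of _ "supp x \<union> supp y"]) (auto, auto simp: supp_def)
  then show ?thesis by (simp add: plus_fsvec_def coord_Abs_fsvec)
qed

lemma coord_minus: "coord (x - y) i = coord x i - coord y i"
proof -
  have "finite {i. coord x i - coord y i \<noteq> 0}"
    by (rule finite_subset[of _ "supp x \<union> supp y"]) (auto, auto simp: supp_def)
  then show ?thesis by (simp add: minus_fsvec_def coord_Abs_fsvec)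
qed

lemma coord_uminus: "coord (- x) i = - coord x i"
  using coord[of x] by (simp add: uminus_fsvec_def coord_Abs_fsvec)

lemma coord_scaleR: "coord (c *\<^sub>R x) i = c * coord x i"
proof -
  have "finite {i. c * coord x i \<noteq> 0}"
    by (rule finite_subset[of _ "supp x"]) (auto, auto simp: supp_def)
  then show ?thesis by (simp add: scaleR_fsvec_def coord_Abs_fsvec)
qed

lemma inner_fsvec_superset:
  assumes "finite A" "supp x \<subseteq> A"
  shows "x \<bullet> y = (\<Sum>i\<in>A. coord x i * coord y i)"
  unfolding inner_fsvec_def using assms
  by (intro sum.mono_neutral_left) (auto simp: supp_def)

instance
proof
  fix x y z :: fsvec and a b :: real
  note [simp] = coord_zero coord_plus coord_minus coord_uminus coord_scaleR
  show "x + y + z = x + (y + z)" "x + y = y + x" "0 + x = x" "- x + x = 0"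
    "x - y = x + - y" "a *\<^sub>R (x + y) = a *\<^sub>R x + a *\<^sub>R y"
    "(a + b) *\<^sub>R x = a *\<^sub>R x + b *\<^sub>R x" "a *\<^sub>R b *\<^sub>R x = (a * b) *\<^sub>R x" "1 *\<^sub>R x = x"
    by (auto intro!: fsvec_eqI simp: algebra_simps)
  show "dist x y = norm (x - y)" by (rule dist_fsvec_def)
  show "sgn x = inverse (norm x) *\<^sub>R x" by (rule sgn_fsvec_def)
  show "uniformity = (INF e\<in>{0<..}. principal {(x :: fsvec, y). dist x y < e})"
    by (rule uniformity_fsvec_def)
  show "open U \<longleftrightarrow> (\<forall>x\<in>U. \<forall>\<^sub>F (x', y) in uniformity. x' = x \<longrightarrow> y \<in> U)" for U :: "fsvec set"
    by (rule open_fsvec_def)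
  show "x \<bullet> y = y \<bullet> x"
    by (simp add: inner_fsvec_def mult.commute Int_commute)
  have s: "supp (x + y) \<subseteq> supp x \<union> supp y" "supp (a *\<^sub>R x) \<subseteq> supp x"
    by (auto simp: supp_def)
  show "(x + y) \<bullet> z = x \<bullet> z + y \<bullet> z"
    by (subst (1 2 3) inner_fsvec_superset[of "supp x \<union> supp y"])
      (use s in \<open>auto simp: sum.distrib algebra_simps\<close>)
  show "(a *\<^sub>R x) \<bullet> y = a * (x \<bullet> y)"
    by (subst (1 2) inner_fsvec_superset[of "supp x"])
      (use s in \<open>auto simp: sum_distrib_left algebra_simps\<close>)
  show "0 \<le> x \<bullet> x"
    by (auto simp: inner_fsvec_def intro!: sum_nonneg)
  have "x \<bullet> x = 0 \<longleftrightarrow> (\<forall>i\<in>supp x. coord x i * coord x i = 0)"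
    unfolding inner_fsvec_def Int_absorb by (rule sum_nonneg_eq_0_iff) auto
  also have "\<dots> \<longleftrightarrow> x = 0"
    by (auto simp: supp_def intro: fsvec_eqI)
  finally show "x \<bullet> x = 0 \<longleftrightarrow> x = 0" .
  show "norm x = sqrt (x \<bullet> x)" by (rule norm_fsvec_def)
qed

end

definition Rn :: "nat \<Rightarrow> fsvec set" where
  "Rn m = {x. supp x \<subseteq> {..<m}}"

definition max_norm :: "nat \<Rightarrow> fsvec \<Rightarrow> real" where
  "max_norm m x = Max ((\<lambda>i. \<bar>coord x i\<bar>) ` {..<m})"

(* Since Q is bounded, C is automatically the recession cone of \<Psi>.  The condition C \<noteq> {} is
   there because the library predicate cone admits the empty set. *)
definition motzkin_decomposition :: "nat \<Rightarrow> fsvec set \<Rightarrow> fsvec set \<Rightarrow> fsvec set \<Rightarrow> bool" where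
  "motzkin_decomposition m \<Psi> Q C \<longleftrightarrow>
     \<Psi> \<subseteq> Rn m \<and> closed \<Psi> \<and> convex \<Psi> \<and>
     Q \<subseteq> Rn m \<and> Q \<noteq> {} \<and> compact Q \<and> convex Q \<and>
     C \<subseteq> Rn m \<and> C \<noteq> {} \<and> closed C \<and> convex C \<and> cone C \<and>
     \<Psi> = {q + c | q c. q \<in> Q \<and> c \<in> C}"

definition polar_cone :: "nat \<Rightarrow> fsvec set \<Rightarrow> fsvec set" where
  "polar_cone m C = {p \<in> Rn m. \<forall>c\<in>C. p \<bullet> c \<le> 0}"

(* The library's closest_point needs a Heine-Borel type. *)
definition proj :: "fsvec set \<Rightarrow> fsvec \<Rightarrow> fsvec" where
  "proj S u = arg_min (dist u) (\<lambda>q. q \<in> S)"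

(* decisions (r, x, y) *)
type_synonym decision = "real \<times> fsvec \<times> fsvec"

definition reward :: "decision \<Rightarrow> real" where
  "reward = (\<lambda>(r, x, y). r)"

definition impact :: "decision \<Rightarrow> fsvec" where
  "impact = (\<lambda>(r, x, y). y)"

definition decision_set :: "nat \<Rightarrow> nat \<Rightarrow> decision set \<Rightarrow> bool" where
  "decision_set n m \<Omega> \<longleftrightarrow> \<Omega> \<noteq> {} \<and> compact \<Omega> \<and> \<Omega> \<subseteq> UNIV \<times> Rn n \<times> Rn m"

definition regular ::
  "nat \<Rightarrow> fsvec set \<Rightarrow> fsvec set \<Rightarrow> real \<Rightarrow> real \<Rightarrow> real \<Rightarrow> decision set \<Rightarrow> bool" where
  "regular m \<Psi> Q d\<^sub>y d\<^sub>r d\<^sub>l \<Omega> \<longleftrightarrow>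
     (\<forall>\<omega>\<in>\<Omega>. \<forall>v\<in>Q. max_norm m (impact \<omega> - v) \<le> d\<^sub>y) \<and>
     (\<exists>\<omega>\<in>convex hull \<Omega>. reward \<omega> \<ge> (SUP \<omega>'\<in>\<Omega>. reward \<omega>') - d\<^sub>r \<and>
        (\<forall>b\<in>Rn m. norm b \<le> 1 \<longrightarrow> impact \<omega> + d\<^sub>l *\<^sub>R b \<in> \<Psi>))"

definition feasible_values :: "nat \<Rightarrow> fsvec set \<Rightarrow> (nat \<Rightarrow> decision set) \<Rightarrow> real set" where
  "feasible_values T \<Psi> \<Omega> =
     {\<Sum>t=1..T. reward (\<omega> t) | \<omega>.
        (\<forall>t\<in>{1..T}. \<omega> t \<in> convex hull \<Omega> t) \<and>
        (\<Sum>t=1..T. impact (\<omega> t)) \<in> (\<lambda>\<psi>. real T *\<^sub>R \<psi>) ` \<Psi>}"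

definition z_R :: "nat \<Rightarrow> fsvec set \<Rightarrow> (nat \<Rightarrow> decision set) \<Rightarrow> real" where
  "z_R T \<Psi> \<Omega> = Sup (feasible_values T \<Psi> \<Omega>)"

(* The benchmark is the same for \<Omega> t = Z (\<pi> t) and for Z itself. *)
lemma z_R_permute:
  assumes "\<pi> permutes {1..T}"
  shows "z_R T \<Psi> (\<lambda>t. Z (\<pi> t)) = z_R T \<Psi> Z"
proof -
  have sub: "feasible_values T \<Psi> (\<lambda>t. Z (\<pi> t)) \<subseteq> feasible_values T \<Psi> Z"
    if p: "\<pi> permutes {1..T}" for \<pi> and Z :: "nat \<Rightarrow> decision set"
  proof
    fix s assume "s \<in> feasible_values T \<Psi> (\<lambda>t. Z (\<pi> t))"
    then obtain \<omega> where \<omega>: "s = (\<Sum>t=1..T. reward (\<omega> t))"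
      "\<forall>t\<in>{1..T}. \<omega> t \<in> convex hull Z (\<pi> t)"
      "(\<Sum>t=1..T. impact (\<omega> t)) \<in> (\<lambda>\<psi>. real T *\<^sub>R \<psi>) ` \<Psi>"
      by (auto simp: feasible_values_def)
    have q: "inv \<pi> permutes {1..T}" using p by (rule permutes_inv)
    have "\<omega> (inv \<pi> t) \<in> convex hull Z t" if "t \<in> {1..T}" for t
      using \<omega>(2) permutes_in_image[OF q, of t] that permutes_inverses(1)[OF p, of t] by metis
    moreover have "(\<Sum>t=1..T. reward (\<omega> (inv \<pi> t))) = (\<Sum>t=1..T. reward (\<omega> t))"
      using sum.permute[OF q, of "\<lambda>t. reward (\<omega> t)"] by (simp add: comp_def)
    moreover have "(\<Sum>t=1..T. impact (\<omega> (inv \<pi> t))) = (\<Sum>t=1..T. impact (\<omega> t))"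
      using sum.permute[OF q, of "\<lambda>t. impact (\<omega> t)"] by (simp add: comp_def)
    ultimately show "s \<in> feasible_values T \<Psi> Z"
      unfolding feasible_values_def using \<omega>(1,3)
      by (auto intro!: exI[of _ "\<lambda>t. \<omega> (inv \<pi> t)"])
  qed
  have "feasible_values T \<Psi> Z \<subseteq> feasible_values T \<Psi> (\<lambda>t. Z (\<pi> t))"
    using sub[OF permutes_inv[OF assms], of "\<lambda>t. Z (\<pi> t)"]
    by (simp add: permutes_inverses(1)[OF assms])
  then show ?thesis
    using sub[OF assms, of Z] by (simp add: z_R_def)
qed

definition primal_dual_run ::
  "nat \<Rightarrow> nat \<Rightarrow> fsvec set \<Rightarrow> fsvec set \<Rightarrow> (nat \<Rightarrow> real) \<Rightarrow> (nat \<Rightarrow> decision set) \<Rightarrow>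
   (nat \<Rightarrow> decision) \<Rightarrow> (nat \<Rightarrow> fsvec) \<Rightarrow> (nat \<Rightarrow> fsvec) \<Rightarrow> bool" where
  "primal_dual_run T m Q C \<eta> \<Omega> \<omega> v p \<longleftrightarrow>
     p 1 = 0 \<and>
     (\<forall>t\<in>{1..T}.
        is_arg_max (\<lambda>\<omega>'. reward \<omega>' - p t \<bullet> impact \<omega>') (\<lambda>\<omega>'. \<omega>' \<in> \<Omega> t) (\<omega> t) \<and>
        is_arg_max (\<lambda>v'. p t \<bullet> v') (\<lambda>v'. v' \<in> Q) (v t) \<and>
        p (t + 1) = proj (polar_cone m C) (p t - \<eta> t *\<^sub>R (v t - impact (\<omega> t))))"

definition grouping :: "nat \<Rightarrow> nat \<Rightarrow> (nat \<Rightarrow> nat set) \<Rightarrow> bool" where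
  "grouping T K G \<longleftrightarrow>
     disjoint_family_on G {1..K} \<and> (\<forall>k\<in>{1..K}. G k \<noteq> {}) \<and> (\<Union>k\<in>{1..K}. G k) = {1..T}"

(* Draw independently, for each k, a uniformly random permutation \<sigma> k of G k, and glue them. *)
definition grouped_permutation :: "nat \<Rightarrow> (nat \<Rightarrow> nat set) \<Rightarrow> (nat \<Rightarrow> nat) pmf" where
  "grouped_permutation K G =
     map_pmf (\<lambda>\<sigma> t. if t \<in> (\<Union>k\<in>{1..K}. G k) then \<sigma> (THE k. k \<in> {1..K} \<and> t \<in> G k) t else t)
       (Pi_pmf {1..K} id (\<lambda>k. pmf_of_set {\<tau>. \<tau> permutes G k}))"

(* The choices at time t, made in scenario \<pi>, depend only on the sets Z (\<pi> 1), ..., Z (\<pi> t). *)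
definition online ::
  "nat \<Rightarrow> (nat \<Rightarrow> decision set) \<Rightarrow> (nat \<Rightarrow> nat) set \<Rightarrow>
   ((nat \<Rightarrow> nat) \<Rightarrow> nat \<Rightarrow> decision) \<Rightarrow> ((nat \<Rightarrow> nat) \<Rightarrow> nat \<Rightarrow> fsvec) \<Rightarrow> bool" where
  "online T Z S \<omega> v \<longleftrightarrow>
     (\<forall>\<pi>\<in>S. \<forall>\<pi>'\<in>S. \<forall>t\<in>{1..T}.
        (\<forall>s\<in>{1..t}. Z (\<pi> s) = Z (\<pi>' s)) \<longrightarrow> \<omega> \<pi> t = \<omega> \<pi>' t \<and> v \<pi> t = v \<pi>' t)"

definition step_dist :: "(nat \<Rightarrow> real) \<Rightarrow> nat \<Rightarrow> nat \<Rightarrow> real" where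
  "step_dist \<eta> i j =
     (if i < j then \<Sum>t\<in>{i..<j}. \<eta> t else if j < i then \<Sum>t\<in>{j..<i}. \<eta> t else 0)"

definition wasserstein :: "(nat \<Rightarrow> real) \<Rightarrow> nat \<Rightarrow> nat set \<Rightarrow> real" where
  "wasserstein \<eta> T A =
     Inf {\<Sum>i\<in>A. \<Sum>j\<in>{1..T}. step_dist \<eta> i j * q i j | q :: nat \<Rightarrow> nat \<Rightarrow> real.
            (\<forall>i\<in>A. \<forall>j\<in>{1..T}. q i j \<ge> 0) \<and>
            (\<forall>j\<in>{1..T}. (\<Sum>i\<in>A. q i j) = 1 / real T) \<and>
            (\<forall>i\<in>A. (\<Sum>j\<in>{1..T}. q i j) = 1 / real (card A))}"

definition unevenness :: "nat \<Rightarrow> (nat \<Rightarrow> real) \<Rightarrow> nat \<Rightarrow> nat \<Rightarrow> (nat \<Rightarrow> nat set) \<Rightarrow> real" where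
  "unevenness m \<eta> T K G =
     (\<Sum>k=1..K. real m * real (card (G k)) * wasserstein \<eta> T (G k))"

end

theory Submission
  imports Defs
begin

text \<open>
  Let \<open>r*, y*\<close> be feasible for the benchmark with \<open>\<Sum> y* = T \<psi>\<close>. Optimality of the primal choice
  gives \<open>r\<^sub>t \<ge> r*\<^bsub>\<pi> t\<^esub> + p\<^sub>t \<bullet> (y\<^sub>t - v\<^sub>t) + p\<^sub>t \<bullet> (v\<^sub>t - y*\<^bsub>\<pi> t\<^esub>)\<close>, and \<open>p\<^sub>t \<bullet> v\<^sub>t \<ge> p\<^sub>t \<bullet> \<psi>\<close>. The Slater-type
  condition gives \<open>p\<^sub>t\<close> a drift towards the origin, so it stays in a ball whose radius does not depend
  on \<open>m\<close>; the usual telescoping then bounds the sum of \<open>p\<^sub>t \<bullet> (v\<^sub>t - y\<^sub>t)\<close> by a multiple of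
  \<open>sqrt (m T)\<close>. For \<open>t\<close> in group \<open>k\<close> with mean impact \<open>\<mu>\<^sub>k\<close>, split
  \<open>\<psi> - y*\<^bsub>\<pi> t\<^esub> = (\<psi> - \<mu>\<^sub>k) + (\<mu>\<^sub>k - y*\<^bsub>\<pi> t\<^esub>)\<close>. The first part is paid for by \<open>W\<close>: the weighted sum of
  the \<open>\<psi> - \<mu>\<^sub>k\<close> vanishes, and \<open>p\<close> is Lipschitz for the step-size distance, so any coupling of the
  uniform distributions on the group and on the horizon bounds it. In the second part \<open>p\<^sub>t\<close> does not
  change when \<open>t\<close> is swapped with a later index of its group, so \<open>y*\<^bsub>\<pi> t\<^esub>\<close> may be replaced by the
  average over the remaining indices, whose second moment is that of sampling without replacement.
  Working with Euclidean norms throughout, no logarithmic factor appears in this argument.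
\<close>

section \<open>Euclidean projections among finitely supported sequences\<close>

definition axis_fsvec :: "nat \<Rightarrow> fsvec" where
  "axis_fsvec i = Abs_fsvec (\<lambda>j. if j = i then 1 else 0)"

lemma coord_axis_fsvec: "coord (axis_fsvec i) j = (if j = i then 1 else 0)"
  unfolding axis_fsvec_def by (subst coord_Abs_fsvec) auto

lemma supp_axis_fsvec: "supp (axis_fsvec i) = {i}"
  by (auto simp: supp_def coord_axis_fsvec)

lemma inner_axis_fsvec: "x \<bullet> axis_fsvec i = coord x i"
proof -
  have "axis_fsvec i \<bullet> x = (\<Sum>j\<in>{i}. coord (axis_fsvec i) j * coord x j)"
    by (rule inner_fsvec_superset) (auto simp: supp_axis_fsvec)
  then show ?thesis by (simp add: coord_axis_fsvec inner_commute)
qed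

lemma abs_coord_le_norm: "\<bar>coord x i\<bar> \<le> norm x"
proof -
  have "norm (axis_fsvec i) = 1"
    by (simp add: norm_eq_sqrt_inner inner_axis_fsvec coord_axis_fsvec)
  then show ?thesis
    using Cauchy_Schwarz_ineq2[of x "axis_fsvec i"] by (simp add: inner_axis_fsvec)
qed

lemma Rn_iff: "x \<in> Rn m \<longleftrightarrow> (\<forall>i\<ge>m. coord x i = 0)"
  by (auto simp: Rn_def supp_def subset_iff) (metis not_le)

lemma Rn_eq_halfspaces: "Rn m = (\<Inter>i\<in>{m..}. {x. axis_fsvec i \<bullet> x = 0})"
  by (auto simp: Rn_iff inner_axis_fsvec inner_commute)

lemma closed_Rn: "closed (Rn m)"
  unfolding Rn_eq_halfspaces by (intro closed_INT ballI closed_hyperplane)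

lemma subspace_Rn: "subspace (Rn m)"
  by (auto simp: subspace_def Rn_iff coord_zero coord_plus coord_scaleR)

lemma norm_Rn_le:
  assumes "x \<in> Rn m" "\<And>i. i < m \<Longrightarrow> \<bar>coord x i\<bar> \<le> B" "0 \<le> B"
  shows "norm x \<le> sqrt (real m) * B"
proof -
  have "x \<bullet> x = (\<Sum>i<m. coord x i * coord x i)"
    by (rule inner_fsvec_superset) (use assms(1) in \<open>auto simp: Rn_def\<close>)
  also have "\<dots> \<le> (\<Sum>i<m. B\<^sup>2)"
    using assms(2,3) by (intro sum_mono) (fastforce simp flip: power2_eq_square abs_le_square_iff)
  finally have "sqrt (x \<bullet> x) \<le> sqrt (real m * B\<^sup>2)" by simp
  then show ?thesis using assms(3) by (simp add: norm_eq_sqrt_inner real_sqrt_mult)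
qed

lemma norm_le_max_norm:
  assumes "x \<in> Rn m" "max_norm m x \<le> B" "0 \<le> B"
  shows "norm x \<le> sqrt (real m) * B"
proof (rule norm_Rn_le[OF assms(1) _ assms(3)])
  fix i assume "i < m"
  then have "\<bar>coord x i\<bar> \<le> max_norm m x" unfolding max_norm_def by (intro Max_ge) auto
  then show "\<bar>coord x i\<bar> \<le> B" using assms(2) by simp
qed

lemma Rn_expand: "x \<in> Rn m \<Longrightarrow> (\<Sum>i<m. coord x i *\<^sub>R axis_fsvec i) = x"
proof (rule fsvec_eqI)
  fix j assume x: "x \<in> Rn m"
  have "coord (\<Sum>i<m. coord x i *\<^sub>R axis_fsvec i) j
    = (\<Sum>i<m. coord x i *\<^sub>R axis_fsvec i) \<bullet> axis_fsvec j" by (simp only: inner_axis_fsvec)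
  also have "\<dots> = (\<Sum>i<m. if i = j then coord x i else 0)"
    unfolding inner_sum_left by (intro sum.cong) (auto simp: inner_axis_fsvec[of "axis_fsvec _"] coord_axis_fsvec)
  also have "\<dots> = coord x j" using x by (auto simp: Rn_iff)
  finally show "coord (\<Sum>i<m. coord x i *\<^sub>R axis_fsvec i) j = coord x j" .
qed

text \<open>Tychonoff replaces a Heine-Borel argument. The box of coefficient sequences is compact
  in the product topology, \<open>f\<close> is continuous on it because it reads only the first
  \<open>m\<close> coefficients, and \<open>S\<close> is a closed subset of the image.\<close>

lemma bounded_closed_Rn_imp_compact:
  assumes "closed S" "S \<subseteq> Rn m" "\<And>x. x \<in> S \<Longrightarrow> norm x \<le> B"
  shows "compact S"
proof -
  define f :: "(nat \<Rightarrow> real) \<Rightarrow> fsvec" where "f = (\<lambda>a. \<Sum>i<m. a i *\<^sub>R axis_fsvec i)"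
  have "compactin (product_topology (\<lambda>_. euclidean) UNIV) (PiE UNIV (\<lambda>_::nat. {-B..B::real}))"
    by (subst compactin_PiE) auto
  then have "compact (PiE UNIV (\<lambda>_::nat. {-B..B::real}))"
    by (simp add: euclidean_product_topology)
  moreover have "continuous_on (PiE UNIV (\<lambda>_::nat. {-B..B::real})) f"
    unfolding f_def
    by (intro continuous_on_sum continuous_on_scaleR continuous_on_const
        continuous_on_subset[OF continuous_on_product_coordinates]) auto
  ultimately have "compact (f ` PiE UNIV (\<lambda>_. {-B..B}))"
    by (rule compact_continuous_image[rotated])
  moreover have S: "S \<subseteq> f ` PiE UNIV (\<lambda>_. {-B..B})"
  proof
    fix x assume x: "x \<in> S"
    have "f (coord x) = x" using x assms(2) Rn_expand by (auto simp: f_def)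
    moreover have "coord x \<in> PiE UNIV (\<lambda>_. {-B..B})"
      using assms(3)[OF x] abs_coord_le_norm[of x]
      by (auto simp: abs_le_iff) (smt (verit) minus_le_iff order_trans)+
    ultimately show "x \<in> f ` PiE UNIV (\<lambda>_. {-B..B})" by (metis imageI)
  qed
  ultimately have "compact (f ` PiE UNIV (\<lambda>_. {-B..B}) \<inter> S)"
    using assms(1) by (intro compact_Int_closed)
  then show ?thesis
    using S by (simp add: Int_absorb1)
qed

text \<open>Points farther from \<open>u\<close> than some fixed \<open>s\<close> in
  \<open>S\<close> cannot be minimizers, so the search may be restricted to a ball about
  \<open>u\<close>, where \<open>S\<close> is compact.\<close>

lemma is_arg_min_proj:
  assumes "closed S" "S \<subseteq> Rn m" "S \<noteq> {}"
  shows "is_arg_min (dist u) (\<lambda>q. q \<in> S) (proj S u)"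
proof -
  obtain s where s: "s \<in> S" using assms(3) by blast
  have "compact (S \<inter> cball u (dist u s))"
  proof (rule bounded_closed_Rn_imp_compact[where B = "norm u + dist u s"])
    fix x assume "x \<in> S \<inter> cball u (dist u s)"
    then show "norm x \<le> norm u + dist u s"
      using norm_triangle_ineq[of u "x - u"] by (simp add: dist_norm norm_minus_commute)
  qed (use assms in auto)
  then obtain q where q: "q \<in> S \<inter> cball u (dist u s)"
    "\<And>z. z \<in> S \<inter> cball u (dist u s) \<Longrightarrow> dist u q \<le> dist u z"
    using continuous_attains_inf[of "S \<inter> cball u (dist u s)" "dist u"] s
    by (force intro!: continuous_intros)
  have "is_arg_min (dist u) (\<lambda>q. q \<in> S) q"
    unfolding is_arg_min_linorder using q by (auto, smt (verit))
  then show ?thesis unfolding proj_def arg_min_def by (rule someI)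
qed

lemma proj_in:
  assumes "closed S" "S \<subseteq> Rn m" "S \<noteq> {}"
  shows "proj S u \<in> S"
  using is_arg_min_proj[OF assms] by (auto simp: is_arg_min_def)

text \<open>At the projection the directions to \<open>u\<close> and to any \<open>q\<close> in the
  convex set \<open>S\<close> form an angle of at least 90 degrees. Expanding
  \<open>norm (u - q)\<close> squared around the projection therefore leaves only nonnegative extra
  terms.\<close>

lemma norm_proj_diff_le:
  assumes "closed S" "S \<subseteq> Rn m" "convex S" "q \<in> S"
  shows "norm (proj S u - q) \<le> norm (u - q)"
proof -
  have "is_arg_min (dist u) (\<lambda>q. q \<in> S) (proj S u)"
    using assms is_arg_min_proj by blast
  then have "(u - proj S u) \<bullet> (q - proj S u) \<le> 0"
    using assms by (intro any_closest_point_dot) (auto simp: is_arg_min_linorder)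
  moreover have "(norm (u - q))\<^sup>2 = (norm (u - proj S u))\<^sup>2 + (norm (proj S u - q))\<^sup>2
      - 2 * ((u - proj S u) \<bullet> (q - proj S u))"
    by (simp add: power2_norm_eq_inner inner_diff_left inner_diff_right inner_commute)
  ultimately have "(norm (proj S u - q))\<^sup>2 \<le> (norm (u - q))\<^sup>2"
    using zero_le_power2[of "norm (u - proj S u)"] by linarith
  then show ?thesis by (rule power2_le_imp_le) simp
qed

section \<open>Projection onto the polar cone\<close>

lemma closed_polar_cone: "closed (polar_cone m C)"
proof -
  have "polar_cone m C = Rn m \<inter> (\<Inter>c\<in>C. {p. c \<bullet> p \<le> 0})"
    by (auto simp: polar_cone_def inner_commute)
  then show ?thesis
    by (auto intro!: closed_Int closed_INT closed_Rn closed_halfspace_le)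
qed

lemma convex_polar_cone: "convex (polar_cone m C)"
proof -
  have "polar_cone m C = Rn m \<inter> (\<Inter>c\<in>C. {p. c \<bullet> p \<le> 0})"
    by (auto simp: polar_cone_def inner_commute)
  then show ?thesis
    by (auto intro!: convex_Int convex_INT subspace_imp_convex[OF subspace_Rn] convex_halfspace_le)
qed

lemma zero_in_polar_cone: "0 \<in> polar_cone m C"
  by (simp add: polar_cone_def subspace_0[OF subspace_Rn])

lemma proj_polar_cone_in: "proj (polar_cone m C) u \<in> polar_cone m C"
  using zero_in_polar_cone by (intro proj_in[OF closed_polar_cone, of m]) (force simp: polar_cone_def)+

lemma norm_proj_polar_cone_diff_le:
  "q \<in> polar_cone m C \<Longrightarrow> norm (proj (polar_cone m C) u - q) \<le> norm (u - q)"
  by (rule norm_proj_diff_le[OF closed_polar_cone _ convex_polar_cone, of m])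
    (auto simp: polar_cone_def)

section \<open>Primal-dual runs\<close>

lemma continuous_on_reward: "continuous_on S reward"
  by (auto simp: reward_def case_prod_beta intro!: continuous_intros)

lemma reward_linear: "reward (u *\<^sub>R a + w *\<^sub>R b) = u * reward a + w * reward b"
  by (simp add: reward_def case_prod_beta)

lemma impact_linear: "impact (u *\<^sub>R a + w *\<^sub>R b) = u *\<^sub>R impact a + w *\<^sub>R impact b"
  by (simp add: impact_def case_prod_beta)

lemma bdd_above_reward: "decision_set n m \<Omega> \<Longrightarrow> bdd_above (reward ` \<Omega>)"
  unfolding decision_set_def
  by (intro bounded_imp_bdd_above compact_imp_bounded compact_continuous_image
      continuous_on_reward) auto

text \<open>The Lagrangian is linear in the decision, so convexifying cannot raise its maximum. This
  lets the choice made in a possibly non-convex set compete with benchmark and Slater points of its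
  hull.\<close>

lemma convex_hull_lagrangian_le:
  assumes "\<And>a. a \<in> \<Omega> \<Longrightarrow> reward a - p \<bullet> impact a \<le> c" "a \<in> convex hull \<Omega>"
  shows "reward a - p \<bullet> impact a \<le> c"
proof -
  have "convex {a. reward a - p \<bullet> impact a \<le> c}"
  proof (rule convexI)
    fix a b and u w :: real
    assume "a \<in> {a. reward a - p \<bullet> impact a \<le> c}" "b \<in> {a. reward a - p \<bullet> impact a \<le> c}"
      and uw: "0 \<le> u" "0 \<le> w" "u + w = 1"
    then have "u * (reward a - p \<bullet> impact a) + w * (reward b - p \<bullet> impact b) \<le> c"
      by (intro convex_bound_le) auto
    then show "u *\<^sub>R a + w *\<^sub>R b \<in> {a. reward a - p \<bullet> impact a \<le> c}"
      by (simp add: reward_linear impact_linear inner_add_right algebra_simps)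
  qed
  then have "convex hull \<Omega> \<subseteq> {a. reward a - p \<bullet> impact a \<le> c}"
    using assms(1) by (intro hull_minimal) auto
  then show ?thesis using assms(2) by auto
qed

text \<open>Passing from the max norm of the regularity condition to the Euclidean norm costs the
  factor \<open>sqrt (real m)\<close>. The bound extends to the hull because balls are
  convex.\<close>

lemma regular_norm_impact_diff_le:
  assumes "regular m \<Psi> Q d\<^sub>y d\<^sub>r d\<^sub>l \<Omega>" "decision_set n m \<Omega>" "q \<in> Q" "Q \<subseteq> Rn m" "0 \<le> d\<^sub>y"
    "a \<in> convex hull \<Omega>"
  shows "norm (impact a - q) \<le> sqrt (real m) * d\<^sub>y"
proof -
  let ?B = "{a. norm (impact a - q) \<le> sqrt (real m) * d\<^sub>y}"
  have "convex ?B"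
  proof (rule convexI)
    fix a b and u w :: real
    assume ab: "a \<in> ?B" "b \<in> ?B" and uw: "0 \<le> u" "0 \<le> w" "u + w = 1"
    have "u *\<^sub>R impact a + w *\<^sub>R impact b \<in> cball q (sqrt (real m) * d\<^sub>y)"
      using ab by (intro convexD[OF convex_cball] uw) (auto simp: dist_norm norm_minus_commute)
    then show "u *\<^sub>R a + w *\<^sub>R b \<in> ?B"
      by (simp add: impact_linear dist_norm norm_minus_commute)
  qed
  moreover have "\<Omega> \<subseteq> ?B"
  proof
    fix a assume a: "a \<in> \<Omega>"
    then have "impact a - q \<in> Rn m"
      using assms by (intro subspace_diff subspace_Rn)
        (auto simp: decision_set_def impact_def case_prod_beta)
    moreover have "max_norm m (impact a - q) \<le> d\<^sub>y" using assms a by (auto simp: regular_def)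
    ultimately show "a \<in> ?B" using norm_le_max_norm assms(5) by blast
  qed
  ultimately show ?thesis using hull_minimal[of \<Omega> ?B convex] assms(6) by auto
qed

lemma sum_inverse_sqrt_le: "(\<Sum>t=1..n. 1 / sqrt (real t)) \<le> 2 * sqrt (real n)"
proof (induction n)
  case (Suc n)
  \<comment> \<open>The arithmetic-geometric mean inequality, which after division by
    \<open>sqrt (real (Suc n))\<close> says that one more summand is at most the increase of
    \<open>2 * sqrt (real n)\<close>.\<close>
  have "sqrt (real n) * sqrt (real (Suc n)) \<le> (real n + real (Suc n)) / 2"
    using arith_geo_mean_sqrt[of "real n" "real (Suc n)"] by (simp add: real_sqrt_mult)
  then have "1 + 2 * sqrt (real n) * sqrt (real (Suc n)) \<le> 2 * (sqrt (real (Suc n)) * sqrt (real (Suc n)))"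
    by simp
  then have "2 * sqrt (real n) + 1 / sqrt (real (Suc n)) \<le> 2 * sqrt (real (Suc n))"
    by (simp add: field_simps del: real_sqrt_mult_self)
  then show ?case using Suc.IH by simp
qed simp

text \<open>Summation by parts: each increment of the nondecreasing weights \<open>h\<close>
  multiplies a value of \<open>a\<close>, which is at most \<open>A\<close>, and
  \<open>a 1 = 0\<close> removes the initial boundary term. It serves for \<open>a\<close> the
  squared dual norms and \<open>h\<close> the inverse step sizes.\<close>

lemma abel_sum_ge:
  fixes a h :: "nat \<Rightarrow> real"
  assumes "a 1 = 0" "\<And>t. t \<in> {1..n+1} \<Longrightarrow> a t \<le> A" "\<And>t. t \<in> {1..n} \<Longrightarrow> h 1 \<le> h t"
    "\<And>t. t \<in> {1..<n} \<Longrightarrow> h t \<le> h (Suc t)" "1 \<le> n"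
  shows "a (n + 1) * h n - A * (h n - h 1) \<le> (\<Sum>t=1..n. (a (t + 1) - a t) * h t)"
  using assms(5,2,3,4)
proof (induction n rule: dec_induct)
  case base
  then show ?case using assms(1) by simp
next
  case (step n)
  have "a (n + 1) * (h (Suc n) - h n) \<le> A * (h (Suc n) - h n)"
    using step by (intro mult_right_mono) auto
  moreover have "a (n + 1) * h n - A * (h n - h 1) \<le> (\<Sum>t=1..n. (a (t + 1) - a t) * h t)"
    using step by auto
  ultimately show ?case by (simp add: algebra_simps)
qed

section \<open>Deterministic analysis of a single run\<close>

locale primal_dual =
  fixes m n T :: nat and \<Psi> Q C :: "fsvec set" and d\<^sub>y d\<^sub>r d\<^sub>l :: real
    and \<eta> :: "nat \<Rightarrow> real" and \<Omega> :: "nat \<Rightarrow> decision set"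
    and \<omega> :: "nat \<Rightarrow> decision" and v p :: "nat \<Rightarrow> fsvec"
  assumes m: "m \<ge> 1" and T: "T \<ge> 1"
    and motzkin: "motzkin_decomposition m \<Psi> Q C"
    and decision: "\<And>t. t \<in> {1..T} \<Longrightarrow> decision_set n m (\<Omega> t)"
    and reg: "\<And>t. t \<in> {1..T} \<Longrightarrow> regular m \<Psi> Q d\<^sub>y d\<^sub>r d\<^sub>l (\<Omega> t)"
    and eta: "\<And>t. t \<in> {1..T} \<Longrightarrow> \<eta> t = min (1 / real m) (1 / sqrt (real m * real t))"
    and run: "primal_dual_run T m Q C \<eta> \<Omega> \<omega> v p"
    and d_pos: "d\<^sub>y > 0" "d\<^sub>r > 0" "d\<^sub>l > 0"
begin

text \<open>A subgradient at \<open>p t\<close> of the dual function sending a price to the maximal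
  Lagrangian over \<open>\<Omega> t\<close> plus the support function of \<open>Q\<close>; the dual
  update is thus a projected subgradient step.\<close>

definition gap :: "nat \<Rightarrow> fsvec" where
  "gap t = v t - impact (\<omega> t)"

text \<open>Built from the three regularity constants alone, so that outside the locale it can enter
  the constant of the theorem, which is fixed before \<open>m\<close>, \<open>T\<close> and the
  sets.\<close>

definition dual_bound :: real where
  "dual_bound = (d\<^sub>r + d\<^sub>y\<^sup>2 / 2) / d\<^sub>l + d\<^sub>y"

lemma Q_subset: "Q \<subseteq> Rn m"
  using motzkin by (simp add: motzkin_decomposition_def)

lemma choice_in: "t \<in> {1..T} \<Longrightarrow> \<omega> t \<in> \<Omega> t" "t \<in> {1..T} \<Longrightarrow> v t \<in> Q"
  using run by (auto simp: primal_dual_run_def is_arg_max_def)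

lemma dual_in_polar: "t \<in> {1..T+1} \<Longrightarrow> p t \<in> polar_cone m C"
proof (cases t)
  case (Suc s)
  assume "t \<in> {1..T+1}"
  then show ?thesis
    using Suc run zero_in_polar_cone proj_polar_cone_in
    by (cases s) (auto simp: primal_dual_run_def)
qed simp

text \<open>Projection moves no farther from points of the cone. Taking \<open>q = 0\<close> yields
  the recursion for the dual norm, and \<open>q = p t\<close> bounds the length of a step.\<close>

lemma dual_step:
  assumes "t \<in> {1..T}" "q \<in> polar_cone m C"
  shows "norm (p (t + 1) - q) \<le> norm (p t - \<eta> t *\<^sub>R gap t - q)"
  using assms run norm_proj_polar_cone_diff_le by (auto simp: primal_dual_run_def gap_def)

lemma norm_gap_le:
  assumes t: "t \<in> {1..T}"
  shows "norm (gap t) \<le> sqrt (real m) * d\<^sub>y"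
  using regular_norm_impact_diff_le[OF reg[OF t] decision[OF t] choice_in(2)[OF t] Q_subset _
      hull_inc[OF choice_in(1)[OF t]]] d_pos
  by (simp add: gap_def norm_minus_commute)

lemma norm_gap_sq_le: "t \<in> {1..T} \<Longrightarrow> (norm (gap t))\<^sup>2 \<le> real m * d\<^sub>y\<^sup>2"
  using power_mono[OF norm_gap_le, of t 2] by (simp add: power_mult_distrib)

text \<open>A price in the polar cone gains nothing along recession directions, so maximizing over
  \<open>Q\<close> already maximizes over \<open>\<Psi>\<close>.\<close>

lemma support_le:
  assumes "t \<in> {1..T}" "\<psi> \<in> \<Psi>"
  shows "p t \<bullet> \<psi> \<le> p t \<bullet> v t"
proof -
  obtain q c where qc: "\<psi> = q + c" "q \<in> Q" "c \<in> C"
    using assms(2) motzkin by (auto simp: motzkin_decomposition_def)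
  have "p t \<bullet> c \<le> 0" using dual_in_polar[of t] assms qc by (simp add: polar_cone_def)
  moreover have "p t \<bullet> q \<le> p t \<bullet> v t"
    using run assms qc by (auto simp: primal_dual_run_def is_arg_max_linorder)
  ultimately show ?thesis by (simp add: qc inner_add_right)
qed

lemma lagrangian_le:
  assumes "t \<in> {1..T}" "a \<in> convex hull \<Omega> t"
  shows "reward a - p t \<bullet> impact a \<le> reward (\<omega> t) - p t \<bullet> impact (\<omega> t)"
  using run assms
  by (intro convex_hull_lagrangian_le[OF _ assms(2)]) (auto simp: primal_dual_run_def is_arg_max_linorder)

text \<open>The Slater point can be pushed by \<open>d\<^sub>l\<close> in the direction of
  \<open>p t\<close> and remains in \<open>\<Psi>\<close>, so \<open>v t\<close> beats it by
  \<open>d\<^sub>l * norm (p t)\<close>. The primal choice, compared with the same Slater point, can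
  give back at most \<open>d\<^sub>r\<close>.\<close>

lemma drift:
  assumes t: "t \<in> {1..T}"
  shows "d\<^sub>l * norm (p t) - d\<^sub>r \<le> p t \<bullet> gap t"
proof -
  obtain a where a: "a \<in> convex hull \<Omega> t" "reward a \<ge> (SUP \<omega>'\<in>\<Omega> t. reward \<omega>') - d\<^sub>r"
    "\<And>b. b \<in> Rn m \<Longrightarrow> norm b \<le> 1 \<Longrightarrow> impact a + d\<^sub>l *\<^sub>R b \<in> \<Psi>"
    using reg[OF t] by (auto simp: regular_def)
  have "reward (\<omega> t) \<le> (SUP \<omega>'\<in>\<Omega> t. reward \<omega>')"
    using t by (intro cSUP_upper choice_in bdd_above_reward[OF decision])
  then have 1: "p t \<bullet> impact (\<omega> t) \<le> p t \<bullet> impact a + d\<^sub>r"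
    using lagrangian_le[OF t a(1)] a(2) by simp
  have "sgn (p t) \<in> Rn m" using dual_in_polar[of t] t
    by (auto simp: sgn_div_norm polar_cone_def intro!: subspace_scale subspace_Rn)
  then have "p t \<bullet> (impact a + d\<^sub>l *\<^sub>R sgn (p t)) \<le> p t \<bullet> v t"
    by (intro support_le[OF t] a(3)) (auto simp: norm_sgn)
  moreover have "p t \<bullet> sgn (p t) = norm (p t)"
    by (cases "p t = 0")
      (simp_all add: sgn_div_norm power2_norm_eq_inner[symmetric] power2_eq_square)
  ultimately show ?thesis using 1
    by (simp add: gap_def inner_diff_right inner_add_right)
qed

section \<open>Step sizes and growth of the dual iterates\<close>

lemma eta_bounds:
  assumes t: "t \<in> {1..T}"
  shows "0 < \<eta> t" "\<eta> t \<le> 1 / real m" "\<eta> t \<le> 1 / sqrt (real m * real t)"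
    "1 / \<eta> t = max (real m) (sqrt (real m * real t))"
  using eta[OF t] t m by (auto simp: min_def max_def field_simps)

lemma eta_mult_m_le: "t \<in> {1..T} \<Longrightarrow> \<eta> t * real m \<le> 1"
  using eta_bounds(2)[of t] m by (simp add: field_simps)

text \<open>The last term is written with two separate factors \<open>\<eta> t\<close> so that one
  of them can be cancelled against the factor in front of the inner product.\<close>

lemma dual_norm_sq_step:
  assumes t: "t \<in> {1..T}"
  shows "(norm (p (t + 1)))\<^sup>2
    \<le> (norm (p t))\<^sup>2 - 2 * \<eta> t * (p t \<bullet> gap t) + \<eta> t * (\<eta> t * (real m * d\<^sub>y\<^sup>2))"
proof -
  have "(norm (p (t + 1)))\<^sup>2 \<le> (norm (p t - \<eta> t *\<^sub>R gap t))\<^sup>2"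
    using dual_step[OF t zero_in_polar_cone] by (intro power_mono) auto
  also have "\<dots> = (norm (p t))\<^sup>2 - 2 * \<eta> t * (p t \<bullet> gap t) + \<eta> t * (\<eta> t * (norm (gap t))\<^sup>2)"
    by (simp add: power2_norm_eq_inner inner_diff_left inner_diff_right inner_commute algebra_simps)
  also have "\<dots> \<le> (norm (p t))\<^sup>2 - 2 * \<eta> t * (p t \<bullet> gap t) + \<eta> t * (\<eta> t * (real m * d\<^sub>y\<^sup>2))"
    using eta_bounds(1)[OF t] norm_gap_sq_le[OF t] by (intro add_left_mono mult_left_mono) auto
  finally show ?thesis .
qed

lemma norm_dual_diff_step:
  assumes t: "t \<in> {1..T}"
  shows "norm (p (t + 1) - p t) \<le> \<eta> t * (sqrt (real m) * d\<^sub>y)"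
proof -
  have "norm (p (t + 1) - p t) \<le> norm (p t - \<eta> t *\<^sub>R gap t - p t)"
    using t by (intro dual_step dual_in_polar) auto
  also have "\<dots> = \<eta> t * norm (gap t)" using eta_bounds(1)[OF t] by simp
  also have "\<dots> \<le> \<eta> t * (sqrt (real m) * d\<^sub>y)"
    using eta_bounds(1)[OF t] norm_gap_le[OF t] by (intro mult_left_mono) auto
  finally show ?thesis .
qed

lemma dual_bound_nonneg: "0 \<le> dual_bound"
  using d_pos by (simp add: dual_bound_def)

text \<open>Beyond the radius \<^term>\<open>(d\<^sub>r + d\<^sub>y\<^sup>2 / 2) / d\<^sub>l\<close> the drift makes the dual norm decrease,
  and a single step changes it by at most \<^term>\<open>d\<^sub>y\<close>.\<close>

lemma norm_dual_le: "t \<in> {1..T+1} \<Longrightarrow> norm (p t) \<le> dual_bound"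
proof (induction t)
  case (Suc t)
  show ?case
  proof (cases "t = 0")
    case True
    then show ?thesis using run dual_bound_nonneg by (simp add: primal_dual_run_def)
  next
    case False
    then have t: "t \<in> {1..T}" using Suc.prems by auto
    show ?thesis
    proof (cases "d\<^sub>l * norm (p t) \<ge> d\<^sub>r + d\<^sub>y\<^sup>2 / 2")
      case True
      have "\<eta> t * (real m * d\<^sub>y\<^sup>2) \<le> d\<^sub>y\<^sup>2"
        using mult_right_mono[OF eta_mult_m_le[OF t], of "d\<^sub>y\<^sup>2"] by simp
      then have "\<eta> t * (\<eta> t * (real m * d\<^sub>y\<^sup>2)) \<le> \<eta> t * (2 * (p t \<bullet> gap t))"
        using drift[OF t] True eta_bounds(1)[OF t] by (intro mult_left_mono) auto
      then have "(norm (p (t + 1)))\<^sup>2 \<le> (norm (p t))\<^sup>2"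
        using dual_norm_sq_step[OF t] mult.left_commute[of "\<eta> t" 2 "p t \<bullet> gap t"]
        unfolding mult.assoc by linarith
      then have "norm (p (t + 1)) \<le> norm (p t)" by (rule power2_le_imp_le) simp
      then show ?thesis using Suc.IH t by auto
    next
      case False
      then have "norm (p t) \<le> (d\<^sub>r + d\<^sub>y\<^sup>2 / 2) / d\<^sub>l" using d_pos by (simp add: field_simps)
      moreover have "\<eta> t * (sqrt (real m) * d\<^sub>y) \<le> d\<^sub>y"
      proof -
        have "sqrt (real m) \<le> real m" using m by (simp add: real_le_lsqrt power2_eq_square)
        then have "\<eta> t * sqrt (real m) \<le> 1"
          using mult_left_mono[of "sqrt (real m)" "real m" "\<eta> t"] eta_bounds(1)[OF t]
            eta_mult_m_le[OF t] by linarith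
        then show ?thesis using mult_right_mono[of "\<eta> t * sqrt (real m)" 1 d\<^sub>y] d_pos by simp
      qed
      ultimately show ?thesis
        using norm_dual_diff_step[OF t] norm_triangle_ineq[of "p t" "p (t + 1) - p t"]
        by (simp add: dual_bound_def)
    qed
  qed
qed simp

text \<open>Single steps add up by the triangle inequality. This Lipschitz property is the link
  between the dual path and the metric behind the Wasserstein distance.\<close>

lemma norm_dual_diff_le:
  assumes "i \<in> {1..T}" "j \<in> {1..T}"
  shows "norm (p i - p j) \<le> step_dist \<eta> i j * (sqrt (real m) * d\<^sub>y)"
proof -
  have *: "norm (p j - p i) \<le> (\<Sum>t\<in>{i..<j}. \<eta> t) * (sqrt (real m) * d\<^sub>y)"
    if "i \<le> j" "1 \<le> i" "j \<le> T" for i j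
    using that
  proof (induction j rule: dec_induct)
    case (step j)
    have "norm (p (Suc j) - p i) \<le> norm (p (j + 1) - p j) + norm (p j - p i)"
      using norm_triangle_ineq[of "p (j + 1) - p j" "p j - p i"] by simp
    also have "\<dots> \<le> \<eta> j * (sqrt (real m) * d\<^sub>y) + (\<Sum>t\<in>{i..<j}. \<eta> t) * (sqrt (real m) * d\<^sub>y)"
      using step by (intro add_mono norm_dual_diff_step) auto
    finally show ?case using step by (simp add: sum.atLeastLessThan_Suc algebra_simps)
  qed simp
  show ?thesis
    using *[of i j] *[of j i] assms
    by (cases i j rule: linorder_cases) (auto simp: step_dist_def norm_minus_commute)
qed

section \<open>Accumulated dual gap and the pathwise reward bound\<close>

lemma sum_eta_le: "real m * (\<Sum>t=1..T. \<eta> t) \<le> 2 * sqrt (real m * real T)"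
proof -
  have "real m * (\<Sum>t=1..T. \<eta> t) \<le> real m * (\<Sum>t=1..T. 1 / sqrt (real m * real t))"
    using eta_bounds(3) by (intro mult_left_mono sum_mono) auto
  also have "\<dots> = (real m / sqrt (real m)) * (\<Sum>t=1..T. 1 / sqrt (real t))"
    by (simp add: sum_distrib_left real_sqrt_mult)
  also have "\<dots> \<le> sqrt (real m) * (2 * sqrt (real T))"
    using sum_inverse_sqrt_le by (simp add: real_div_sqrt mult_left_mono)
  finally show ?thesis by (simp add: real_sqrt_mult)
qed

text \<open>The regret argument of online gradient descent: dividing
  \<open>dual_norm_sq_step\<close> by \<open>2 * \<eta> t\<close> gives differences of squared norms
  weighted by \<open>1 / \<eta> t\<close>, to be summed by parts, plus second-order terms controlled
  by \<open>sum_eta_le\<close>.\<close>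

lemma sum_dual_gap_le:
  "(\<Sum>t=1..T. p t \<bullet> gap t) \<le> (dual_bound\<^sup>2 / 2 + d\<^sub>y\<^sup>2) * sqrt (real m * real T)"
proof -
  define a h where "a = (\<lambda>t. (norm (p t))\<^sup>2)" and "h = (\<lambda>t. max (real m) (sqrt (real m * real t)))"
  have h: "h t = 1 / \<eta> t" if "t \<in> {1..T}" for t using eta_bounds(4)[OF that] by (simp add: h_def)
  have hmono: "h s \<le> h t" if "s \<le> t" for s t
    using that unfolding h_def by (intro max.mono real_sqrt_le_mono mult_left_mono) auto
  have h1: "h 1 = real m"
    using m by (auto simp: h_def real_le_lsqrt power2_eq_square)
  have "p t \<bullet> gap t \<le> - ((a (t + 1) - a t) * h t) / 2 + \<eta> t * (real m * d\<^sub>y\<^sup>2) / 2"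
    if t: "t \<in> {1..T}" for t
    using dual_norm_sq_step[OF t] eta_bounds(1)[OF t] unfolding h[OF t] a_def
    by (simp add: field_simps)
  then have "(\<Sum>t=1..T. p t \<bullet> gap t)
    \<le> (\<Sum>t=1..T. - ((a (t + 1) - a t) * h t) / 2 + \<eta> t * (real m * d\<^sub>y\<^sup>2) / 2)"
    by (rule sum_mono)
  also have "\<dots> = - (\<Sum>t=1..T. (a (t + 1) - a t) * h t) / 2 + d\<^sub>y\<^sup>2 / 2 * (real m * (\<Sum>t=1..T. \<eta> t))"
    by (simp add: sum.distrib sum_subtractf mult.commute flip: sum_divide_distrib sum_distrib_left sum_distrib_right)
  also have "\<dots> \<le> dual_bound\<^sup>2 / 2 * sqrt (real m * real T) + d\<^sub>y\<^sup>2 / 2 * (2 * sqrt (real m * real T))"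
  proof (rule add_mono)
    have "a (T + 1) * h T - dual_bound\<^sup>2 * (h T - h 1) \<le> (\<Sum>t=1..T. (a (t + 1) - a t) * h t)"
      using T run norm_dual_le
      by (intro abel_sum_ge) (auto simp: a_def primal_dual_run_def intro!: hmono power_mono)
    moreover have "0 \<le> a (T + 1) * h T" by (simp add: a_def h_def)
    \<comment> \<open>Subtracting \<open>h 1\<close>, which is \<open>real m\<close>, matters: for
      \<open>T < m\<close> the value \<open>h T\<close> alone would exceed
      \<open>sqrt (real m * real T)\<close>.\<close>
    moreover have "dual_bound\<^sup>2 * (h T - h 1) \<le> dual_bound\<^sup>2 * sqrt (real m * real T)"
      unfolding h1 by (intro mult_left_mono) (auto simp: h_def max_def)
    ultimately show "- (\<Sum>t=1..T. (a (t + 1) - a t) * h t) / 2 \<le> dual_bound\<^sup>2 / 2 * sqrt (real m * real T)"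
      by simp
    show "d\<^sub>y\<^sup>2 / 2 * (real m * (\<Sum>t=1..T. \<eta> t)) \<le> d\<^sub>y\<^sup>2 / 2 * (2 * sqrt (real m * real T))"
      by (intro mult_left_mono sum_eta_le) simp
  qed
  finally show ?thesis by (simp add: algebra_simps)
qed

text \<open>Weak duality at each time: \<open>\<omega> t\<close> is compared with \<open>a t\<close>
  in the Lagrangian and \<open>v t\<close> with \<open>\<psi>\<close> in the support function. What
  remains is the accumulated gap.\<close>

lemma reward_ge:
  assumes "\<psi> \<in> \<Psi>" "\<And>t. t \<in> {1..T} \<Longrightarrow> a t \<in> convex hull \<Omega> t"
  shows "(\<Sum>t=1..T. reward (a t)) + (\<Sum>t=1..T. p t \<bullet> (\<psi> - impact (a t)))
      - (dual_bound\<^sup>2 / 2 + d\<^sub>y\<^sup>2) * sqrt (real m * real T)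
    \<le> (\<Sum>t=1..T. reward (\<omega> t))"
proof -
  have "reward (a t) + p t \<bullet> (\<psi> - impact (a t)) - p t \<bullet> gap t \<le> reward (\<omega> t)" if t: "t \<in> {1..T}" for t
    using lagrangian_le[OF t assms(2)[OF t]] support_le[OF t assms(1)]
    by (simp add: gap_def inner_diff_right)
  then have "(\<Sum>t=1..T. reward (a t) + p t \<bullet> (\<psi> - impact (a t)) - p t \<bullet> gap t) \<le> (\<Sum>t=1..T. reward (\<omega> t))"
    by (rule sum_mono)
  then show ?thesis using sum_dual_gap_le by (simp add: sum.distrib sum_subtractf)
qed

end

section \<open>Exchangeable permutations\<close>

text \<open>As \<open>t\<close> decreases through \<open>A\<close>, the number of remaining elements
  runs through 1 up to \<open>card A\<close>; inserting a new minimum into \<open>A\<close> adds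
  just the largest count.\<close>

lemma sum_inverse_sqrt_card_le:
  fixes A :: "nat set"
  assumes "finite A"
  shows "(\<Sum>t\<in>A. 1 / sqrt (real (card {s\<in>A. t \<le> s}))) \<le> 2 * sqrt (real (card A))"
proof -
  have "(\<Sum>t\<in>A. 1 / sqrt (real (card {s\<in>A. t \<le> s}))) = (\<Sum>t=1..card A. 1 / sqrt (real t))"
    using assms
  proof (induction A rule: finite_linorder_min_induct)
    case (insert b A)
    have "{s \<in> insert b A. b \<le> s} = insert b A" using insert.hyps by auto
    moreover have "{s \<in> insert b A. t \<le> s} = {s \<in> A. t \<le> s}" if "t \<in> A" for t
      using insert.hyps that by auto
    moreover have "b \<notin> A" using insert.hyps by auto
    ultimately show ?case using insert by simp
  qed simp
  then show ?thesis using sum_inverse_sqrt_le by simp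
qed

text \<open>Jensen's inequality for the uniform distribution on \<open>S\<close>, with averages
  multiplied out by \<open>card S\<close>.\<close>

lemma sum_norm_le_sqrt:
  assumes "finite S" "(\<Sum>\<pi>\<in>S. (norm (f \<pi>))\<^sup>2) \<le> real (card S) * c" "0 \<le> c"
  shows "(\<Sum>\<pi>\<in>S. norm (f \<pi>)) \<le> real (card S) * sqrt c"
proof -
  have "(\<Sum>\<pi>\<in>S. norm (f \<pi>))\<^sup>2 \<le> real (card S) * (\<Sum>\<pi>\<in>S. (norm (f \<pi>))\<^sup>2)"
    using sum_squared_le_sum_of_squares[of "\<lambda>\<pi>. norm (f \<pi>)" S]
    by (simp add: mult.commute)
  also have "\<dots> \<le> real (card S) * (real (card S) * c)"
    using assms by (intro mult_left_mono) auto
  also have "\<dots> = (real (card S) * sqrt c)\<^sup>2"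
    using assms by (simp add: power_mult_distrib power2_eq_square)
  finally show ?thesis by (rule power2_le_imp_le) (use assms in auto)
qed

text \<open>\<^term>\<open>S\<close> stands for the equally likely permutations, \<^term>\<open>A\<close> for one group.\<close>

locale exchangeable =
  fixes S :: "(nat \<Rightarrow> nat) set" and A :: "nat set"
  assumes finite_S: "finite S" and finite_A: "finite A"
    and bij: "\<And>\<pi>. \<pi> \<in> S \<Longrightarrow> bij_betw \<pi> A A"
    and swap: "\<And>\<pi> a b. \<pi> \<in> S \<Longrightarrow> a \<in> A \<Longrightarrow> b \<in> A \<Longrightarrow> \<pi> \<circ> Transposition.transpose a b \<in> S"
begin

text \<open>Composition with a transposition is an involution on \<open>S\<close>, hence only
  reorders the sum.\<close>

lemma sum_swap:
  assumes "a \<in> A" "b \<in> A"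
  shows "(\<Sum>\<pi>\<in>S. f (\<pi> \<circ> Transposition.transpose a b)) = (\<Sum>\<pi>\<in>S. f \<pi>)"
  by (rule sum.reindex_bij_witness[of _ "\<lambda>\<pi>. \<pi> \<circ> Transposition.transpose a b" "\<lambda>\<pi>. \<pi> \<circ> Transposition.transpose a b"])
    (use swap assms in \<open>auto simp: o_assoc[symmetric]\<close>)

text \<open>All cross terms with a fixed index are equal by symmetry, and together with the diagonal
  term they sum to zero; hence they are nonpositive, as for sampling without replacement.\<close>

lemma cross_term_nonpos:
  fixes u :: "nat \<Rightarrow> 'a::real_inner"
  assumes u: "(\<Sum>j\<in>A. u j) = 0" and "a \<in> A" "b \<in> A" "a \<noteq> b"
  shows "(\<Sum>\<pi>\<in>S. u (\<pi> a) \<bullet> u (\<pi> b)) \<le> 0"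
proof -
  have eq: "(\<Sum>\<pi>\<in>S. u (\<pi> a) \<bullet> u (\<pi> c)) = (\<Sum>\<pi>\<in>S. u (\<pi> a) \<bullet> u (\<pi> b))" if "c \<in> A - {a}" for c
    using sum_swap[of b c "\<lambda>\<pi>. u (\<pi> a) \<bullet> u (\<pi> b)"] that assms by simp
  have "(\<Sum>c\<in>A. u (\<pi> c)) = 0" if "\<pi> \<in> S" for \<pi>
    using sum.reindex_bij_betw[OF bij[OF that], of u] u by simp
  then have "0 = (\<Sum>\<pi>\<in>S. u (\<pi> a) \<bullet> (\<Sum>c\<in>A. u (\<pi> c)))" by simp
  also have "\<dots> = (\<Sum>c\<in>A. \<Sum>\<pi>\<in>S. u (\<pi> a) \<bullet> u (\<pi> c))"
    by (subst sum.swap) (simp add: inner_sum_right)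
  also have "\<dots> = (\<Sum>\<pi>\<in>S. u (\<pi> a) \<bullet> u (\<pi> a)) + (\<Sum>c\<in>A-{a}. \<Sum>\<pi>\<in>S. u (\<pi> a) \<bullet> u (\<pi> c))"
    using finite_A assms by (subst sum.remove[of A a]) auto
  also have "\<dots> = (\<Sum>\<pi>\<in>S. u (\<pi> a) \<bullet> u (\<pi> a))
      + real (card (A - {a})) * (\<Sum>\<pi>\<in>S. u (\<pi> a) \<bullet> u (\<pi> b))"
    by (simp add: eq)
  finally have "real (card (A - {a})) * (\<Sum>\<pi>\<in>S. u (\<pi> a) \<bullet> u (\<pi> b)) \<le> 0"
    using sum_nonneg[of S "\<lambda>\<pi>. u (\<pi> a) \<bullet> u (\<pi> a)"] by simp
  moreover have "real (card (A - {a})) > 0"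
    using assms finite_A unfolding of_nat_0_less_iff card_gt_0_iff by auto
  ultimately show ?thesis by (simp add: mult_le_0_iff)
qed

text \<open>Expanding the square and dropping the nonpositive cross terms leaves only the diagonal,
  so the second moment grows linearly rather than quadratically in \<open>card B\<close>.\<close>

lemma sum_norm_sq_partial_le:
  fixes u :: "nat \<Rightarrow> 'a::real_inner"
  assumes u: "(\<Sum>j\<in>A. u j) = 0" and R: "\<And>j. j \<in> A \<Longrightarrow> norm (u j) \<le> r" and B: "B \<subseteq> A"
  shows "(\<Sum>\<pi>\<in>S. (norm (\<Sum>s\<in>B. u (\<pi> s)))\<^sup>2) \<le> real (card S) * (real (card B) * r\<^sup>2)"
proof -
  have fB: "finite B" using B finite_A finite_subset by blast
  have "(\<Sum>\<pi>\<in>S. (norm (\<Sum>s\<in>B. u (\<pi> s)))\<^sup>2) = (\<Sum>s\<in>B. \<Sum>t\<in>B. \<Sum>\<pi>\<in>S. u (\<pi> s) \<bullet> u (\<pi> t))"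
    by (simp add: power2_norm_eq_inner inner_sum_left inner_sum_right sum.swap[of _ _ S])
      (rule sum.swap)
  also have "\<dots> \<le> (\<Sum>s\<in>B. \<Sum>t\<in>B. if t = s then real (card S) * r\<^sup>2 else 0)"
  proof (intro sum_mono)
    fix s t assume st: "s \<in> B" "t \<in> B"
    have "u (\<pi> s) \<bullet> u (\<pi> s) \<le> r\<^sup>2" if "\<pi> \<in> S" for \<pi>
    proof -
      have "\<pi> s \<in> A" using bij[OF that] st B by (auto simp: bij_betw_def)
      then show ?thesis
        using power_mono[OF R, of "\<pi> s" 2] by (simp add: power2_norm_eq_inner)
    qed
    then have "(\<Sum>\<pi>\<in>S. u (\<pi> s) \<bullet> u (\<pi> s)) \<le> real (card S) * r\<^sup>2"
      using sum_bounded_above[of S "\<lambda>\<pi>. u (\<pi> s) \<bullet> u (\<pi> s)"] by simp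
    then show "(\<Sum>\<pi>\<in>S. u (\<pi> s) \<bullet> u (\<pi> t)) \<le> (if t = s then real (card S) * r\<^sup>2 else 0)"
      using cross_term_nonpos[OF u, of s t] st B by auto
  qed
  also have "\<dots> = real (card S) * (real (card B) * r\<^sup>2)"
    using fB by (simp add: algebra_simps)
  finally show ?thesis .
qed

text \<open>Predictability of \<^term>\<open>f\<close> means that it ignores how the values of \<^term>\<open>\<pi>\<close> from
  time \<^term>\<open>t\<close> on are swapped; so \<^term>\<open>u (\<pi> t)\<close> may be replaced by its average over the
  remaining indices of the group.\<close>

lemma sum_predictable_inner_le:
  fixes u :: "nat \<Rightarrow> 'a::real_inner"
  assumes u: "(\<Sum>j\<in>A. u j) = 0" and R: "\<And>j. j \<in> A \<Longrightarrow> norm (u j) \<le> r" and "0 \<le> r"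
    and t: "t \<in> A"
    and pred: "\<And>\<pi> s. \<pi> \<in> S \<Longrightarrow> s \<in> A \<Longrightarrow> t \<le> s \<Longrightarrow> f (\<pi> \<circ> Transposition.transpose t s) = f \<pi>"
    and D: "\<And>\<pi>. \<pi> \<in> S \<Longrightarrow> norm (f \<pi>) \<le> D" and "0 \<le> D"
  shows "(\<Sum>\<pi>\<in>S. f \<pi> \<bullet> u (\<pi> t)) \<le> real (card S) * (D * r / sqrt (real (card {s\<in>A. t \<le> s})))"
proof -
  define B where "B = {s\<in>A. t \<le> s}"
  have B: "B \<subseteq> A" "finite B" "0 < real (card B)"
    using finite_A t by (auto simp: B_def card_gt_0_iff)
  have eq: "(\<Sum>\<pi>\<in>S. f \<pi> \<bullet> u (\<pi> s)) = (\<Sum>\<pi>\<in>S. f \<pi> \<bullet> u (\<pi> t))" if "s \<in> B" for s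
  proof -
    have "(\<Sum>\<pi>\<in>S. f \<pi> \<bullet> u (\<pi> t))
        = (\<Sum>\<pi>\<in>S. f (\<pi> \<circ> Transposition.transpose t s) \<bullet> u ((\<pi> \<circ> Transposition.transpose t s) t))"
      using that t by (intro sum_swap[symmetric]) (auto simp: B_def)
    also have "\<dots> = (\<Sum>\<pi>\<in>S. f \<pi> \<bullet> u (\<pi> s))"
      using that pred by (intro sum.cong) (auto simp: B_def)
    finally show ?thesis by simp
  qed
  have "real (card B) * (\<Sum>\<pi>\<in>S. f \<pi> \<bullet> u (\<pi> t)) = (\<Sum>s\<in>B. \<Sum>\<pi>\<in>S. f \<pi> \<bullet> u (\<pi> s))"
    by (simp add: eq)
  also have "\<dots> = (\<Sum>\<pi>\<in>S. f \<pi> \<bullet> (\<Sum>s\<in>B. u (\<pi> s)))"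
    by (subst sum.swap) (simp add: inner_sum_right)
  also have "\<dots> \<le> (\<Sum>\<pi>\<in>S. D * norm (\<Sum>s\<in>B. u (\<pi> s)))"
    by (intro sum_mono order_trans[OF norm_cauchy_schwarz] mult_right_mono D) auto
  also have "\<dots> = D * (\<Sum>\<pi>\<in>S. norm (\<Sum>s\<in>B. u (\<pi> s)))" by (simp add: sum_distrib_left)
  also have "\<dots> \<le> D * (real (card S) * sqrt (real (card B) * r\<^sup>2))"
    using \<open>0 \<le> D\<close> B R by (intro mult_left_mono sum_norm_le_sqrt finite_S sum_norm_sq_partial_le u) auto
  also have "\<dots> = real (card B) * (real (card S) * (D * r / sqrt (real (card B))))"
    using B(3) \<open>0 \<le> r\<close> by (simp add: real_sqrt_mult field_simps)
  finally show ?thesis using B(3) by (simp add: B_def[symmetric] del: times_divide_eq_right)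
qed

lemma sum_group_predictable_inner_le:
  fixes u :: "nat \<Rightarrow> 'a::real_inner"
  assumes u: "(\<Sum>j\<in>A. u j) = 0" and R: "\<And>j. j \<in> A \<Longrightarrow> norm (u j) \<le> r" and "0 \<le> r"
    and pred: "\<And>\<pi> t s. \<pi> \<in> S \<Longrightarrow> t \<in> A \<Longrightarrow> s \<in> A \<Longrightarrow> t \<le> s \<Longrightarrow> f (\<pi> \<circ> Transposition.transpose t s) t = f \<pi> t"
    and D: "\<And>\<pi> t. \<pi> \<in> S \<Longrightarrow> t \<in> A \<Longrightarrow> norm (f \<pi> t) \<le> D" and "0 \<le> D"
  shows "(\<Sum>t\<in>A. \<Sum>\<pi>\<in>S. f \<pi> t \<bullet> u (\<pi> t)) \<le> real (card S) * (2 * D * r * sqrt (real (card A)))"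
proof -
  have "(\<Sum>t\<in>A. \<Sum>\<pi>\<in>S. f \<pi> t \<bullet> u (\<pi> t))
    \<le> (\<Sum>t\<in>A. real (card S) * (D * r / sqrt (real (card {s\<in>A. t \<le> s}))))"
    using assms by (intro sum_mono sum_predictable_inner_le) auto
  also have "\<dots> = real (card S) * (D * r * (\<Sum>t\<in>A. 1 / sqrt (real (card {s\<in>A. t \<le> s}))))"
    by (simp add: sum_distrib_left)
  also have "\<dots> \<le> real (card S) * (D * r * (2 * sqrt (real (card A))))"
    using assms by (intro mult_left_mono sum_inverse_sqrt_card_le finite_A) auto
  finally show ?thesis by (simp add: algebra_simps)
qed

end

section \<open>Couplings and grouped permutations\<close>

lemma wasserstein_ge:
  assumes "finite A" "A \<noteq> {}" "T \<ge> 1"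
    and "\<And>q. (\<And>i j. i \<in> A \<Longrightarrow> j \<in> {1..T} \<Longrightarrow> q i j \<ge> 0) \<Longrightarrow>
      (\<And>j. j \<in> {1..T} \<Longrightarrow> (\<Sum>i\<in>A. q i j) = 1 / real T) \<Longrightarrow>
      (\<And>i. i \<in> A \<Longrightarrow> (\<Sum>j=1..T. q i j) = 1 / real (card A)) \<Longrightarrow>
      c \<le> (\<Sum>i\<in>A. \<Sum>j=1..T. step_dist \<eta> i j * q i j)"
  shows "c \<le> wasserstein \<eta> T A"
  unfolding wasserstein_def
proof (rule cInf_greatest)
  have "card A > 0" using assms by (simp add: card_gt_0_iff)
  then show "{\<Sum>i\<in>A. \<Sum>j=1..T. step_dist \<eta> i j * q i j | q :: nat \<Rightarrow> nat \<Rightarrow> real.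
      (\<forall>i\<in>A. \<forall>j\<in>{1..T}. q i j \<ge> 0) \<and> (\<forall>j\<in>{1..T}. (\<Sum>i\<in>A. q i j) = 1 / real T) \<and>
      (\<forall>i\<in>A. (\<Sum>j=1..T. q i j) = 1 / real (card A))} \<noteq> {}"
    \<comment> \<open>The product of the two uniform distributions is a coupling, so the infimum
      ranges over a nonempty set.\<close>
    using assms(3) by (auto intro!: exI[of _ "\<lambda>_ _. 1 / (real T * real (card A))"])
qed (use assms(4) in blast)

lemma wasserstein_nonneg:
  assumes "finite A" "A \<noteq> {}" "T \<ge> 1" "A \<subseteq> {1..T}" "\<And>t. t \<in> {1..T} \<Longrightarrow> 0 \<le> \<eta> t"
  shows "0 \<le> wasserstein \<eta> T A"
proof (rule wasserstein_ge[OF assms(1-3)])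
  fix q :: "nat \<Rightarrow> nat \<Rightarrow> real"
  assume q: "\<And>i j. i \<in> A \<Longrightarrow> j \<in> {1..T} \<Longrightarrow> q i j \<ge> 0"
  have "0 \<le> step_dist \<eta> i j" if "i \<in> A" "j \<in> {1..T}" for i j
    using that assms(4) by (auto simp: step_dist_def subset_iff intro!: sum_nonneg assms(5))
  then show "0 \<le> (\<Sum>i\<in>A. \<Sum>j=1..T. step_dist \<eta> i j * q i j)"
    using q by (intro sum_nonneg mult_nonneg_nonneg) auto
qed

text \<open>The easy direction of Kantorovich-Rubinstein duality: the map from \<open>j\<close> to
  \<open>p j \<bullet> a\<close> is Lipschitz with constant \<open>L * R\<close> for
  \<open>step_dist\<close>, so its means over \<open>A\<close> and over the horizon differ by at
  most \<open>L * R\<close> times the distance.\<close>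

lemma coupling_inner_le:
  fixes p :: "nat \<Rightarrow> 'a::real_inner"
  assumes A: "finite A" "A \<noteq> {}" "A \<subseteq> {1..T}" and T: "T \<ge> 1"
    and lip: "\<And>i j. i \<in> {1..T} \<Longrightarrow> j \<in> {1..T} \<Longrightarrow> norm (p i - p j) \<le> step_dist \<eta> i j * L"
    and a: "norm a \<le> R" and LR: "0 < L" "0 < R"
  shows "(\<Sum>t\<in>A. p t \<bullet> a) - real (card A) / real T * (\<Sum>j=1..T. p j \<bullet> a)
    \<le> L * R * (real (card A) * wasserstein \<eta> T A)"
proof -
  have N: "0 < real (card A)" using A by (simp add: card_gt_0_iff)
  let ?X = "(\<Sum>t\<in>A. p t \<bullet> a) / real (card A) - (\<Sum>j=1..T. p j \<bullet> a) / real T"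
  have "?X / (L * R) \<le> wasserstein \<eta> T A"
  proof (rule wasserstein_ge[OF A(1,2) T])
    fix q :: "nat \<Rightarrow> nat \<Rightarrow> real"
    assume q: "\<And>i j. i \<in> A \<Longrightarrow> j \<in> {1..T} \<Longrightarrow> q i j \<ge> 0"
      "\<And>j. j \<in> {1..T} \<Longrightarrow> (\<Sum>i\<in>A. q i j) = 1 / real T"
      "\<And>i. i \<in> A \<Longrightarrow> (\<Sum>j=1..T. q i j) = 1 / real (card A)"
    \<comment> \<open>The two marginal conditions turn both means into sums against the same
      coupling \<open>q\<close>.\<close>
    have "(\<Sum>t\<in>A. p t \<bullet> a) / real (card A) = (\<Sum>i\<in>A. (p i \<bullet> a) * (\<Sum>j=1..T. q i j))"
      using q(3) by (simp add: sum_divide_distrib)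
    moreover have "(\<Sum>j=1..T. p j \<bullet> a) / real T = (\<Sum>j=1..T. (p j \<bullet> a) * (\<Sum>i\<in>A. q i j))"
      using q(2) by (simp add: sum_divide_distrib)
    moreover have "\<dots> = (\<Sum>i\<in>A. \<Sum>j=1..T. (p j \<bullet> a) * q i j)"
      by (subst sum.swap) (simp add: sum_distrib_left)
    ultimately have "?X = (\<Sum>i\<in>A. \<Sum>j=1..T. ((p i - p j) \<bullet> a) * q i j)"
      by (simp add: sum_distrib_left sum_subtractf inner_diff_left algebra_simps)
    also have "\<dots> \<le> (\<Sum>i\<in>A. \<Sum>j=1..T. (step_dist \<eta> i j * L * R) * q i j)"
    proof (intro sum_mono mult_right_mono q)
      fix i j assume ij: "i \<in> A" "j \<in> {1..T}"
      have "(p i - p j) \<bullet> a \<le> norm (p i - p j) * norm a" by (rule norm_cauchy_schwarz)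
      also have "\<dots> \<le> step_dist \<eta> i j * L * R"
        using lip[of i j] ij A(3) a order_trans[OF norm_ge_zero lip[of i j]]
        by (intro mult_mono) auto
      finally show "(p i - p j) \<bullet> a \<le> step_dist \<eta> i j * L * R" .
    qed
    also have "\<dots> = L * R * (\<Sum>i\<in>A. \<Sum>j=1..T. step_dist \<eta> i j * q i j)"
      by (simp add: sum_distrib_left mult_ac)
    finally show "?X / (L * R) \<le> (\<Sum>i\<in>A. \<Sum>j=1..T. step_dist \<eta> i j * q i j)"
      using LR by (simp add: divide_le_eq mult.commute)
  qed
  then have "?X \<le> L * R * wasserstein \<eta> T A" using LR by (simp add: divide_le_eq mult.commute)
  then have "real (card A) * ?X \<le> real (card A) * (L * R * wasserstein \<eta> T A)"
    using N by (intro mult_left_mono) auto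
  then show ?thesis using N by (simp add: algebra_simps)
qed

lemma sum_grouping:
  assumes "grouping T K G"
  shows "(\<Sum>t=1..T. f t) = (\<Sum>k=1..K. \<Sum>t\<in>G k. f t)"
proof -
  have "finite (G k)" if "k \<in> {1..K}" for k
    using assms that by (intro finite_subset[of "G k" "{1..T}"]) (auto simp: grouping_def)
  then show ?thesis
    using assms unfolding grouping_def
    by (subst sum.UNION_disjoint[symmetric]) (auto simp: disjoint_family_on_def)
qed

text \<open>The gluing map inside \<open>grouped_permutation\<close>, named so that its injectivity
  can be stated.\<close>

definition glue :: "nat \<Rightarrow> (nat \<Rightarrow> nat set) \<Rightarrow> (nat \<Rightarrow> nat \<Rightarrow> nat) \<Rightarrow> nat \<Rightarrow> nat" where
  "glue K G \<sigma> t =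
     (if t \<in> (\<Union>k\<in>{1..K}. G k) then \<sigma> (THE k. k \<in> {1..K} \<and> t \<in> G k) t else t)"

lemma glue_eq:
  assumes "disjoint_family_on G {1..K}" "k \<in> {1..K}" "t \<in> G k"
  shows "glue K G \<sigma> t = \<sigma> k t"
proof -
  have "(THE k. k \<in> {1..K} \<and> t \<in> G k) = k"
    using assms by (intro the_equality) (unfold disjoint_family_on_def, blast+)
  then show ?thesis using assms by (auto simp: glue_def)
qed

section \<open>The grouped permutation as a uniform choice from a finite set\<close>

locale grouped =
  fixes T K :: nat and G :: "nat \<Rightarrow> nat set"
  assumes grouping: "grouping T K G"
begin

definition scenarios :: "(nat \<Rightarrow> nat) set" where
  "scenarios = set_pmf (grouped_permutation K G)"

text \<open>The default \<open>id\<close> outside the index range agrees with the default of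
  \<open>Pi_pmf\<close> in \<open>grouped_permutation\<close>.\<close>

abbreviation permutation_families :: "(nat \<Rightarrow> nat \<Rightarrow> nat) set" where
  "permutation_families \<equiv> PiE_dflt {1..K} id (\<lambda>k. {\<tau>. \<tau> permutes G k})"

lemma disjoint: "disjoint_family_on G {1..K}"
  using grouping by (simp add: grouping_def)

lemma group_subset: "k \<in> {1..K} \<Longrightarrow> G k \<subseteq> {1..T}"
  using grouping by (auto simp: grouping_def)

lemma finite_group: "k \<in> {1..K} \<Longrightarrow> finite (G k)"
  using group_subset finite_subset by blast

lemma group_nonempty: "k \<in> {1..K} \<Longrightarrow> G k \<noteq> {}"
  using grouping by (auto simp: grouping_def)

lemma in_group: "t \<in> {1..T} \<Longrightarrow> \<exists>k\<in>{1..K}. t \<in> G k"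
  using grouping by (auto simp: grouping_def)

lemma finite_families: "finite permutation_families"
  by (intro finite_PiE_dflt finite_permutations finite_group) auto

lemma families_nonempty: "permutation_families \<noteq> {}"
proof -
  have "(\<lambda>_. id) \<in> permutation_families" by (auto simp: PiE_dflt_def permutes_id)
  then show ?thesis by blast
qed

text \<open>The glued map shows \<open>\<sigma> k\<close> on \<open>G k\<close>; elsewhere
  \<open>\<sigma> k\<close> is the identity, either as a permutation of \<open>G k\<close> or as the
  default for other indices.\<close>

lemma inj_on_glue: "inj_on (glue K G) permutation_families"
proof (rule inj_onI, rule ext, rule ext)
  fix \<sigma> \<sigma>' k t
  assume *: "\<sigma> \<in> permutation_families" "\<sigma>' \<in> permutation_families" "glue K G \<sigma> = glue K G \<sigma>'"
  show "\<sigma> k t = \<sigma>' k t"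
  proof (cases "k \<in> {1..K}")
    case True
    show ?thesis
    proof (cases "t \<in> G k")
      case t: True
      then show ?thesis
        using glue_eq[OF disjoint True t, of \<sigma>] glue_eq[OF disjoint True t, of \<sigma>'] * by simp
    next
      case False
      have "\<sigma> k permutes G k" "\<sigma>' k permutes G k" using * True by (auto simp: PiE_dflt_def)
      then show ?thesis using False permutes_not_in by metis
    qed
  qed (use * in \<open>auto simp: PiE_dflt_def\<close>)
qed

text \<open>Independent uniform draws are uniform on the product, and an injective map preserves
  uniformity. Expectations thereby become plain averages over \<open>scenarios\<close>.\<close>

lemma grouped_permutation_eq:
  "grouped_permutation K G = pmf_of_set (glue K G ` permutation_families)"
proof -
  have "grouped_permutation K G = map_pmf (glue K G) (pmf_of_set permutation_families)"
    unfolding grouped_permutation_def glue_def[abs_def]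
    using finite_group
    by (subst Pi_pmf_of_set) (auto simp: finite_permutations intro: permutes_id)
  then show ?thesis
    by (simp only: map_pmf_of_set_inj[OF inj_on_glue families_nonempty finite_families])
qed

lemma scenarios_eq: "scenarios = glue K G ` permutation_families"
  using finite_families families_nonempty by (simp add: scenarios_def grouped_permutation_eq)

lemma finite_scenarios: "finite scenarios"
  using finite_families by (simp add: scenarios_eq)

lemma scenarios_nonempty: "scenarios \<noteq> {}"
  by (simp add: scenarios_def set_pmf_not_empty)

lemma expectation_eq:
  fixes f :: "(nat \<Rightarrow> nat) \<Rightarrow> real"
  shows "measure_pmf.expectation (grouped_permutation K G) f = (\<Sum>\<pi>\<in>scenarios. f \<pi>) / real (card scenarios)"
  unfolding grouped_permutation_eq scenarios_eq
  using finite_families families_nonempty by (intro integral_pmf_of_set) auto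

lemma scenario_bij_betw:
  assumes "\<pi> \<in> scenarios" and k: "k \<in> {1..K}"
  shows "bij_betw \<pi> (G k) (G k)"
proof -
  obtain \<sigma> where \<sigma>: "\<pi> = glue K G \<sigma>" "\<sigma> \<in> permutation_families"
    using assms by (auto simp: scenarios_eq)
  then have "bij_betw (\<sigma> k) (G k) (G k)" using k by (auto simp: PiE_dflt_def permutes_imp_bij)
  then show ?thesis using glue_eq[OF disjoint k] \<sigma>(1) by (metis bij_betw_cong)
qed

lemma scenario_in: "\<pi> \<in> scenarios \<Longrightarrow> t \<in> {1..T} \<Longrightarrow> \<pi> t \<in> {1..T}"
  using in_group scenario_bij_betw group_subset bij_betwE by blast

text \<open>A swap inside \<open>G k\<close> changes only the component \<open>\<sigma> k\<close>,
  since the transposition fixes all points outside that group.\<close>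

lemma scenario_swap:
  assumes "\<pi> \<in> scenarios" and k: "k \<in> {1..K}" and ab: "a \<in> G k" "b \<in> G k"
  shows "\<pi> \<circ> Transposition.transpose a b \<in> scenarios"
proof -
  obtain \<sigma> where \<sigma>: "\<pi> = glue K G \<sigma>" "\<sigma> \<in> permutation_families"
    using assms by (auto simp: scenarios_eq)
  have "\<pi> \<circ> Transposition.transpose a b = glue K G (\<sigma>(k := \<sigma> k \<circ> Transposition.transpose a b))"
  proof
    fix t
    show "(\<pi> \<circ> Transposition.transpose a b) t = glue K G (\<sigma>(k := \<sigma> k \<circ> Transposition.transpose a b)) t"
    proof (cases "\<exists>l\<in>{1..K}. t \<in> G l")
      case True
      then obtain l where l: "l \<in> {1..K}" "t \<in> G l" by blast
      show ?thesis
      proof (cases "l = k")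
        case True
        moreover have "Transposition.transpose a b t \<in> G k"
          using ab l True by (auto simp: Transposition.transpose_def)
        ultimately show ?thesis using l glue_eq[OF disjoint k] by (simp add: \<sigma>(1))
      next
        case False
        then have "t \<notin> G k" using l k disjoint unfolding disjoint_family_on_def by blast
        then have "Transposition.transpose a b t = t" using ab by (auto simp: Transposition.transpose_def)
        then show ?thesis using l glue_eq[OF disjoint l] False by (simp add: \<sigma>(1))
      qed
    next
      case False
      then have "Transposition.transpose a b t = t" using ab k by (auto simp: Transposition.transpose_def)
      then show ?thesis using False by (auto simp: \<sigma>(1) glue_def)
    qed
  qed
  moreover have "\<sigma>(k := \<sigma> k \<circ> Transposition.transpose a b) \<in> permutation_families"
    using \<sigma>(2) k permutes_compose[OF permutes_swap_id[OF ab], of "\<sigma> k"]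
    by (auto simp: PiE_dflt_def)
  ultimately show ?thesis unfolding scenarios_eq by (metis imageI)
qed

lemma exchangeable_group: "k \<in> {1..K} \<Longrightarrow> exchangeable scenarios (G k)"
  by (rule exchangeable.intro)
    (auto intro: finite_scenarios finite_group scenario_bij_betw scenario_swap)

end

section \<open>Expected reward\<close>

lemma norm_average_diff_le:
  fixes y :: "'b \<Rightarrow> 'a::real_normed_vector"
  assumes "finite A" "A \<noteq> {}" "\<And>j. j \<in> A \<Longrightarrow> norm (y j - q) \<le> B"
  shows "norm ((1 / real (card A)) *\<^sub>R (\<Sum>j\<in>A. y j) - q) \<le> B"
proof -
  have N: "0 < real (card A)" using assms by (simp add: card_gt_0_iff)
  have "(1 / real (card A)) *\<^sub>R (\<Sum>j\<in>A. y j - q) = (1 / real (card A)) *\<^sub>R (\<Sum>j\<in>A. y j) - q"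
    using N by (simp add: sum_subtractf sum_constant_scaleR scaleR_diff_right)
  moreover have "norm (\<Sum>j\<in>A. y j - q) \<le> real (card A) * B"
    using sum_norm_le[of A "\<lambda>j. y j - q" "\<lambda>_. B"] assms(3) by simp
  ultimately show ?thesis
    using N norm_scaleR[of "1 / real (card A)" "\<Sum>j\<in>A. y j - q"]
    by (simp add: divide_le_eq mult.commute)
qed

section \<open>The algorithm under a random order\<close>

locale random_order = grouped +
  fixes m n :: nat and \<Psi> Q C :: "fsvec set" and d\<^sub>y d\<^sub>r d\<^sub>l :: real
    and \<eta> :: "nat \<Rightarrow> real" and Z :: "nat \<Rightarrow> decision set"
    and \<omega> :: "(nat \<Rightarrow> nat) \<Rightarrow> nat \<Rightarrow> decision" and v p :: "(nat \<Rightarrow> nat) \<Rightarrow> nat \<Rightarrow> fsvec"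
  assumes m: "m \<ge> 1" and T: "T \<ge> 1"
    and motzkin: "motzkin_decomposition m \<Psi> Q C"
    and decision: "\<And>t. t \<in> {1..T} \<Longrightarrow> decision_set n m (Z t)"
    and reg: "\<And>t. t \<in> {1..T} \<Longrightarrow> regular m \<Psi> Q d\<^sub>y d\<^sub>r d\<^sub>l (Z t)"
    and eta: "\<And>t. t \<in> {1..T} \<Longrightarrow> \<eta> t = min (1 / real m) (1 / sqrt (real m * real t))"
    and run: "\<And>\<pi>. \<pi> \<in> scenarios \<Longrightarrow>
      primal_dual_run T m Q C \<eta> (\<lambda>t. Z (\<pi> t)) (\<omega> \<pi>) (v \<pi>) (p \<pi>)"
    and online: "online T Z scenarios \<omega> v"
    and d_pos: "d\<^sub>y > 0" "d\<^sub>r > 0" "d\<^sub>l > 0"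
begin

abbreviation D :: real where
  "D \<equiv> primal_dual.dual_bound d\<^sub>y d\<^sub>r d\<^sub>l"

lemma primal_dual:
  assumes \<pi>: "\<pi> \<in> scenarios"
  shows "primal_dual m n T \<Psi> Q C d\<^sub>y d\<^sub>r d\<^sub>l \<eta> (\<lambda>t. Z (\<pi> t)) (\<omega> \<pi>) (v \<pi>) (p \<pi>)"
  by (rule primal_dual.intro[OF m T motzkin decision[OF scenario_in[OF \<pi>]]
        reg[OF scenario_in[OF \<pi>]] eta run[OF \<pi>] d_pos])

lemma D_nonneg: "0 \<le> D"
  using scenarios_nonempty primal_dual primal_dual.dual_bound_nonneg by blast

text \<open>The range of \<open>s\<close> excludes \<open>t\<close>: the price
  \<open>p \<pi> t\<close> is formed before the set at time \<open>t\<close> is seen, so exchanging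
  \<open>t\<close> itself with a later index leaves it unchanged.\<close>

lemma dual_predictable:
  assumes "\<pi> \<in> scenarios" "\<pi>' \<in> scenarios" "t \<in> {1..T}" "\<And>s. s \<in> {1..<t} \<Longrightarrow> \<pi> s = \<pi>' s"
  shows "p \<pi> t = p \<pi>' t"
  using assms(3,4)
proof (induction t)
  case (Suc t)
  show ?case
  proof (cases "t = 0")
    case True
    then show ?thesis using run[OF assms(1)] run[OF assms(2)] by (simp add: primal_dual_run_def)
  next
    case False
    then have t: "t \<in> {1..T}" using Suc.prems by auto
    have "\<omega> \<pi> t = \<omega> \<pi>' t \<and> v \<pi> t = v \<pi>' t"
    proof -
      have "\<forall>s\<in>{1..t}. Z (\<pi> s) = Z (\<pi>' s)" using Suc.prems(2) by simp
      then show ?thesis using online assms(1,2) t unfolding online_def by blast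
    qed
    moreover have "p \<pi> t = p \<pi>' t" using Suc t by auto
    moreover have "p \<pi> (t + 1) = proj (polar_cone m C) (p \<pi> t - \<eta> t *\<^sub>R (v \<pi> t - impact (\<omega> \<pi> t)))"
      "p \<pi>' (t + 1) = proj (polar_cone m C) (p \<pi>' t - \<eta> t *\<^sub>R (v \<pi>' t - impact (\<omega> \<pi>' t)))"
      using run[OF assms(1)] run[OF assms(2)] t by (auto simp: primal_dual_run_def)
    ultimately show ?thesis by simp
  qed
qed simp

lemma sum_scenario: "\<pi> \<in> scenarios \<Longrightarrow> (\<Sum>t=1..T. f (\<pi> t)) = (\<Sum>t=1..T. f t)"
  unfolding sum_grouping[OF grouping]
  by (rule sum.cong[OF refl], rule sum.reindex_bij_betw, rule scenario_bij_betw)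

lemma sum_card_group: "(\<Sum>k=1..K. real (card (G k))) = real T"
  using sum_grouping[OF grouping, of "\<lambda>_. 1::real"] by simp

lemma unevenness_nonneg: "0 \<le> unevenness m \<eta> T K G"
  unfolding unevenness_def
  using T eta by (intro sum_nonneg mult_nonneg_nonneg wasserstein_nonneg finite_group
      group_nonempty group_subset) auto

text \<open>\<open>sqrt (real T)\<close> is the l2 norm of the vector of the
  \<open>sqrt (real (card (G k)))\<close>, and the l2 norm is at most the l1 norm.\<close>

lemma sqrt_horizon_le: "sqrt (real m * real T) \<le> sqrt (real m) * (\<Sum>k=1..K. sqrt (real (card (G k))))"
proof -
  have "sqrt (real T) \<le> (\<Sum>k=1..K. sqrt (real (card (G k))))"
    using L2_set_le_sum[of "{1..K}" "\<lambda>k. sqrt (real (card (G k)))"]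
    by (simp add: L2_set_def flip: sum_card_group)
  then show ?thesis by (simp add: real_sqrt_mult mult_left_mono)
qed

section \<open>Comparison with a fixed solution of the benchmark\<close>

context
  fixes a :: "nat \<Rightarrow> decision" and \<psi> :: fsvec
  assumes a: "\<And>t. t \<in> {1..T} \<Longrightarrow> a t \<in> convex hull Z t"
    and \<psi>: "\<psi> \<in> \<Psi>" "(\<Sum>t=1..T. impact (a t)) = real T *\<^sub>R \<psi>"
begin

definition group_mean :: "nat \<Rightarrow> fsvec" where
  "group_mean k = (1 / real (card (G k))) *\<^sub>R (\<Sum>t\<in>G k. impact (a t))"

lemma card_scaleR_group_mean:
  "k \<in> {1..K} \<Longrightarrow> real (card (G k)) *\<^sub>R group_mean k = (\<Sum>t\<in>G k. impact (a t))"
  using finite_group[of k] group_nonempty[of k] by (simp add: group_mean_def)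

text \<open>All benchmark impacts lie in one ball around a point of \<open>Q\<close>; the group
  means and \<open>\<psi>\<close> are averages of them and stay in it. Any two of these points are
  therefore within twice its radius.\<close>

lemma near_common_point:
  obtains q where "\<And>t. t \<in> {1..T} \<Longrightarrow> norm (impact (a t) - q) \<le> sqrt (real m) * d\<^sub>y"
    "\<And>k. k \<in> {1..K} \<Longrightarrow> norm (group_mean k - q) \<le> sqrt (real m) * d\<^sub>y"
    "norm (\<psi> - q) \<le> sqrt (real m) * d\<^sub>y"
proof -
  obtain q where q: "q \<in> Q" "Q \<subseteq> Rn m"
    using motzkin by (auto simp: motzkin_decomposition_def)
  have 1: "norm (impact (a t) - q) \<le> sqrt (real m) * d\<^sub>y" if "t \<in> {1..T}" for t
    using regular_norm_impact_diff_le[OF reg decision q _ a] that d_pos by simp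
  moreover have "norm (group_mean k - q) \<le> sqrt (real m) * d\<^sub>y" if k: "k \<in> {1..K}" for k
    unfolding group_mean_def
    using k 1 group_subset[OF k] by (intro norm_average_diff_le finite_group group_nonempty) auto
  moreover have "\<psi> = (1 / real (card {1..T})) *\<^sub>R (\<Sum>t=1..T. impact (a t))"
    using T \<psi>(2) by simp
  then have "norm (\<psi> - q) \<le> sqrt (real m) * d\<^sub>y"
    using T 1 norm_average_diff_le[of "{1..T}" "\<lambda>t. impact (a t)" q] by simp
  ultimately show ?thesis using that by blast
qed

lemma unevenness_bound:
  assumes "\<pi> \<in> scenarios"
  shows "(\<Sum>k=1..K. \<Sum>t\<in>G k. p \<pi> t \<bullet> (group_mean k - \<psi>)) \<le> 2 * d\<^sub>y\<^sup>2 * unevenness m \<eta> T K G"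
proof -
  interpret primal_dual m n T \<Psi> Q C d\<^sub>y d\<^sub>r d\<^sub>l \<eta> "\<lambda>t. Z (\<pi> t)" "\<omega> \<pi>" "v \<pi>" "p \<pi>"
    by (rule primal_dual[OF assms])
  obtain q where q: "\<And>k. k \<in> {1..K} \<Longrightarrow> norm (group_mean k - q) \<le> sqrt (real m) * d\<^sub>y"
    "norm (\<psi> - q) \<le> sqrt (real m) * d\<^sub>y" using near_common_point by metis
  have "(\<Sum>t\<in>G k. p \<pi> t \<bullet> (group_mean k - \<psi>))
      - real (card (G k)) / real T * (\<Sum>j=1..T. p \<pi> j \<bullet> (group_mean k - \<psi>))
    \<le> 2 * d\<^sub>y\<^sup>2 * (real m * real (card (G k)) * wasserstein \<eta> T (G k))" if k: "k \<in> {1..K}" for k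
  proof -
    have "norm (group_mean k - \<psi>) \<le> 2 * (sqrt (real m) * d\<^sub>y)"
      using q(1)[OF k] q(2) norm_triangle_ineq4[of "group_mean k - q" "\<psi> - q"] by simp
    then have "(\<Sum>t\<in>G k. p \<pi> t \<bullet> (group_mean k - \<psi>))
      - real (card (G k)) / real T * (\<Sum>j=1..T. p \<pi> j \<bullet> (group_mean k - \<psi>))
      \<le> (sqrt (real m) * d\<^sub>y) * (2 * (sqrt (real m) * d\<^sub>y)) * (real (card (G k)) * wasserstein \<eta> T (G k))"
      using k m T d_pos
      by (intro coupling_inner_le norm_dual_diff_le finite_group group_nonempty group_subset) auto
    \<comment> \<open>One \<open>sqrt (real m)\<close> comes from the Lipschitz constant of the dual
      path and one from the length of \<open>group_mean k - \<psi>\<close>; together they are the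
      factor \<open>real m\<close> in \<open>unevenness\<close>.\<close>
    also have "(sqrt (real m) * d\<^sub>y) * (2 * (sqrt (real m) * d\<^sub>y)) = 2 * d\<^sub>y\<^sup>2 * real m"
      by (simp add: power2_eq_square)
    finally show ?thesis by (simp add: mult.assoc)
  qed
  then have "(\<Sum>k=1..K. (\<Sum>t\<in>G k. p \<pi> t \<bullet> (group_mean k - \<psi>))
      - real (card (G k)) / real T * (\<Sum>j=1..T. p \<pi> j \<bullet> (group_mean k - \<psi>)))
    \<le> 2 * d\<^sub>y\<^sup>2 * unevenness m \<eta> T K G"
    unfolding unevenness_def sum_distrib_left[of "2 * d\<^sub>y\<^sup>2"] by (rule sum_mono)
  \<comment> \<open>The subtracted horizon averages cancel across groups, because the group means
    weighted by group size average to \<open>\<psi>\<close>.\<close>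
  moreover have "(\<Sum>k=1..K. real (card (G k)) / real T * (\<Sum>j=1..T. p \<pi> j \<bullet> (group_mean k - \<psi>))) = 0"
  proof -
    have "(\<Sum>k=1..K. real (card (G k)) *\<^sub>R (group_mean k - \<psi>))
        = (\<Sum>k=1..K. \<Sum>t\<in>G k. impact (a t)) - (\<Sum>k=1..K. real (card (G k))) *\<^sub>R \<psi>"
      by (simp add: scaleR_diff_right card_scaleR_group_mean sum_subtractf flip: scaleR_sum_left)
    also have "\<dots> = 0"
      by (simp only: sum_grouping[OF grouping, symmetric] \<psi>(2) sum_card_group) simp
    finally have *: "(\<Sum>k=1..K. real (card (G k)) *\<^sub>R (group_mean k - \<psi>)) = 0" .
    have "(\<Sum>k=1..K. real (card (G k)) / real T * (\<Sum>j=1..T. p \<pi> j \<bullet> (group_mean k - \<psi>)))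
      = ((\<Sum>j=1..T. p \<pi> j) \<bullet> (\<Sum>k=1..K. real (card (G k)) *\<^sub>R (group_mean k - \<psi>))) / real T"
      by (simp add: inner_sum_right sum_divide_distrib flip: inner_sum_left)
    then show ?thesis unfolding * by simp
  qed
  ultimately show ?thesis by (simp only: sum_subtractf)
qed

lemma sampling_bound:
  "(\<Sum>\<pi>\<in>scenarios. \<Sum>k=1..K. \<Sum>t\<in>G k. p \<pi> t \<bullet> (impact (a (\<pi> t)) - group_mean k))
    \<le> real (card scenarios) * (4 * D * d\<^sub>y * (sqrt (real m) * (\<Sum>k=1..K. sqrt (real (card (G k))))))"
proof -
  obtain q where q: "\<And>t. t \<in> {1..T} \<Longrightarrow> norm (impact (a t) - q) \<le> sqrt (real m) * d\<^sub>y"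
    "\<And>k. k \<in> {1..K} \<Longrightarrow> norm (group_mean k - q) \<le> sqrt (real m) * d\<^sub>y"
    using near_common_point by metis
  have "(\<Sum>t\<in>G k. \<Sum>\<pi>\<in>scenarios. p \<pi> t \<bullet> (impact (a (\<pi> t)) - group_mean k))
    \<le> real (card scenarios) * (2 * D * (2 * (sqrt (real m) * d\<^sub>y)) * sqrt (real (card (G k))))"
    if k: "k \<in> {1..K}" for k
  proof (rule exchangeable.sum_group_predictable_inner_le[OF exchangeable_group[OF k]])
    show "(\<Sum>j\<in>G k. impact (a j) - group_mean k) = 0"
      using k by (simp add: sum_subtractf sum_constant_scaleR card_scaleR_group_mean)
    show "norm (impact (a j) - group_mean k) \<le> 2 * (sqrt (real m) * d\<^sub>y)" if "j \<in> G k" for j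
      using q(1)[of j] q(2)[OF k] group_subset[OF k] that
        norm_triangle_ineq4[of "impact (a j) - q" "group_mean k - q"] by auto
    show "p (\<pi> \<circ> Transposition.transpose t s) t = p \<pi> t"
      if "\<pi> \<in> scenarios" "t \<in> G k" "s \<in> G k" "t \<le> s" for \<pi> t s
      using that group_subset[OF k]
      \<comment> \<open>For \<open>t \<le> s\<close> the transposition fixes every time before
        \<open>t\<close>.\<close>
      by (intro dual_predictable scenario_swap[OF _ k]) (auto simp: Transposition.transpose_def)
    show "norm (p \<pi> t) \<le> D" if "\<pi> \<in> scenarios" "t \<in> G k" for \<pi> t
      using that group_subset[OF k] by (intro primal_dual.norm_dual_le[OF primal_dual]) auto
  qed (use D_nonneg d_pos in auto)
  then have "(\<Sum>k=1..K. \<Sum>t\<in>G k. \<Sum>\<pi>\<in>scenarios. p \<pi> t \<bullet> (impact (a (\<pi> t)) - group_mean k))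
    \<le> (\<Sum>k=1..K. real (card scenarios) * (2 * D * (2 * (sqrt (real m) * d\<^sub>y)) * sqrt (real (card (G k)))))"
    by (rule sum_mono)
  also have "\<dots> = real (card scenarios) * (4 * D * d\<^sub>y * (sqrt (real m) * (\<Sum>k=1..K. sqrt (real (card (G k))))))"
    by (simp add: sum_distrib_left mult_ac)
  finally show ?thesis by (simp only: sum.swap[of _ _ scenarios])
qed

text \<open>All error terms except the sampling error are bounded in every scenario; the sampling
  error \<open>e\<close> is controlled only after summing over the scenarios.\<close>

lemma expected_reward_ge:
  "(\<Sum>t=1..T. reward (a t))
      - (D\<^sup>2 / 2 + 3 * d\<^sub>y\<^sup>2 + 4 * D * d\<^sub>y) * (unevenness m \<eta> T K G
          + sqrt (real m) * (\<Sum>k=1..K. sqrt (real (card (G k)))))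
    \<le> measure_pmf.expectation (grouped_permutation K G) (\<lambda>\<pi>. \<Sum>t=1..T. reward (\<omega> \<pi> t))"
proof -
  define s where "s = sqrt (real m) * (\<Sum>k=1..K. sqrt (real (card (G k))))"
  define W where "W = unevenness m \<eta> T K G"
  define N where "N = real (card scenarios)"
  define e where "e = (\<lambda>\<pi>. \<Sum>k=1..K. \<Sum>t\<in>G k. p \<pi> t \<bullet> (impact (a (\<pi> t)) - group_mean k))"
  define c where "c = (\<Sum>t=1..T. reward (a t)) - 2 * d\<^sub>y\<^sup>2 * W - (D\<^sup>2 / 2 + d\<^sub>y\<^sup>2) * s"
  have N: "0 < N" using finite_scenarios scenarios_nonempty by (simp add: N_def card_gt_0_iff)
  have "c - e \<pi> \<le> (\<Sum>t=1..T. reward (\<omega> \<pi> t))" if \<pi>: "\<pi> \<in> scenarios" for \<pi>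
  proof -
    have "(\<Sum>t=1..T. reward (a (\<pi> t))) + (\<Sum>t=1..T. p \<pi> t \<bullet> (\<psi> - impact (a (\<pi> t))))
      - (D\<^sup>2 / 2 + d\<^sub>y\<^sup>2) * sqrt (real m * real T) \<le> (\<Sum>t=1..T. reward (\<omega> \<pi> t))"
      using scenario_in[OF \<pi>]
      by (intro primal_dual.reward_ge[OF primal_dual[OF \<pi>] \<psi>(1)] a) auto
    moreover have "(\<Sum>t=1..T. p \<pi> t \<bullet> (\<psi> - impact (a (\<pi> t))))
      = - (\<Sum>k=1..K. \<Sum>t\<in>G k. p \<pi> t \<bullet> (group_mean k - \<psi>)) - e \<pi>"
      unfolding sum_grouping[OF grouping] e_def
      by (simp add: inner_diff_right sum_subtractf)
    moreover have "(D\<^sup>2 / 2 + d\<^sub>y\<^sup>2) * sqrt (real m * real T) \<le> (D\<^sup>2 / 2 + d\<^sub>y\<^sup>2) * s"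
      using sqrt_horizon_le by (intro mult_left_mono) (auto simp: s_def)
    ultimately show ?thesis
      using unevenness_bound[OF \<pi>] sum_scenario[OF \<pi>, of "\<lambda>t. reward (a t)"]
      unfolding c_def W_def by linarith
  qed
  then have "(\<Sum>\<pi>\<in>scenarios. c - e \<pi>) \<le> (\<Sum>\<pi>\<in>scenarios. \<Sum>t=1..T. reward (\<omega> \<pi> t))"
    by (rule sum_mono)
  moreover have "(\<Sum>\<pi>\<in>scenarios. e \<pi>) \<le> N * (4 * D * d\<^sub>y * s)"
    using sampling_bound by (simp add: e_def N_def s_def)
  ultimately have "N * (c - 4 * D * d\<^sub>y * s) \<le> (\<Sum>\<pi>\<in>scenarios. \<Sum>t=1..T. reward (\<omega> \<pi> t))"
    by (simp add: sum_subtractf N_def algebra_simps)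
  then have "c - 4 * D * d\<^sub>y * s
    \<le> measure_pmf.expectation (grouped_permutation K G) (\<lambda>\<pi>. \<Sum>t=1..T. reward (\<omega> \<pi> t))"
    unfolding expectation_eq N_def[symmetric] using N by (simp add: le_divide_eq mult.commute)
  \<comment> \<open>\<open>W\<close> and \<open>s\<close> arrive with different coefficients; these
    nonnegative amounts fill them up to one common constant.\<close>
  moreover have "0 \<le> (D\<^sup>2 / 2 + d\<^sub>y\<^sup>2 + 4 * D * d\<^sub>y) * W" "0 \<le> 2 * d\<^sub>y\<^sup>2 * s"
    using unevenness_nonneg D_nonneg d_pos by (auto simp: W_def s_def intro!: mult_nonneg_nonneg sum_nonneg)
  moreover have "(D\<^sup>2 / 2 + 3 * d\<^sub>y\<^sup>2 + 4 * D * d\<^sub>y) * (W + s) = (D\<^sup>2 / 2 + d\<^sub>y\<^sup>2 + 4 * D * d\<^sub>y) * W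
      + 2 * d\<^sub>y\<^sup>2 * W + (D\<^sup>2 / 2 + d\<^sub>y\<^sup>2) * s + 2 * d\<^sub>y\<^sup>2 * s + 4 * D * d\<^sub>y * s"
    by (simp add: field_simps)
  ultimately show ?thesis
    unfolding s_def[symmetric] W_def[symmetric] c_def by linarith
qed

end

end

theorem theorem4p10:
  fixes d\<^sub>y d\<^sub>r d\<^sub>l :: real
  assumes "d\<^sub>y > 0" and "d\<^sub>r > 0" and "d\<^sub>l > 0"
  shows "\<exists>M :: real. \<forall>(m :: nat) (n :: nat) (T :: nat) (K :: nat) (\<Psi> :: fsvec set) (Q :: fsvec set)
           (C :: fsvec set) (Z :: nat \<Rightarrow> decision set) (G :: nat \<Rightarrow> nat set) (\<eta> :: nat \<Rightarrow> real)
           (\<omega> :: (nat \<Rightarrow> nat) \<Rightarrow> nat \<Rightarrow> decision) (v :: (nat \<Rightarrow> nat) \<Rightarrow> nat \<Rightarrow> fsvec)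
           (p :: (nat \<Rightarrow> nat) \<Rightarrow> nat \<Rightarrow> fsvec).
         m \<ge> 1 \<longrightarrow> T \<ge> 1 \<longrightarrow>
         motzkin_decomposition m \<Psi> Q C \<longrightarrow>
         grouping T K G \<longrightarrow>
         (\<forall>t\<in>{1..T}. decision_set n m (Z t)) \<longrightarrow>
         feasible_values T \<Psi> Z \<noteq> {} \<longrightarrow>
         (\<forall>t\<in>{1..T}. regular m \<Psi> Q d\<^sub>y d\<^sub>r d\<^sub>l (Z t)) \<longrightarrow>
         (\<forall>t\<in>{1..T}. \<eta> t = min (1 / real m) (1 / sqrt (real m * real t))) \<longrightarrow>
         (\<forall>\<pi>\<in>set_pmf (grouped_permutation K G).
            primal_dual_run T m Q C \<eta> (\<lambda>t. Z (\<pi> t)) (\<omega> \<pi>) (v \<pi>) (p \<pi>)) \<longrightarrow>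
         online T Z (set_pmf (grouped_permutation K G)) \<omega> v \<longrightarrow>
         measure_pmf.expectation (grouped_permutation K G) (\<lambda>\<pi>. \<Sum>t=1..T. reward (\<omega> \<pi> t))
           \<ge> z_R T \<Psi> Z
              - M * (unevenness m \<eta> T K G
                     + sqrt (real m * max 1 (ln (real m))) * (\<Sum>k=1..K. sqrt (real (card (G k)))))"
proof (intro exI[of _ "(primal_dual.dual_bound d\<^sub>y d\<^sub>r d\<^sub>l)\<^sup>2 / 2 + 3 * d\<^sub>y\<^sup>2
      + 4 * primal_dual.dual_bound d\<^sub>y d\<^sub>r d\<^sub>l * d\<^sub>y"] allI impI)
  fix m n T K :: nat and \<Psi> Q C :: "fsvec set" and Z :: "nat \<Rightarrow> decision set"
    and G :: "nat \<Rightarrow> nat set" and \<eta> :: "nat \<Rightarrow> real"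
    and \<omega> :: "(nat \<Rightarrow> nat) \<Rightarrow> nat \<Rightarrow> decision" and v p :: "(nat \<Rightarrow> nat) \<Rightarrow> nat \<Rightarrow> fsvec"
  let ?D = "primal_dual.dual_bound d\<^sub>y d\<^sub>r d\<^sub>l"
  let ?M = "?D\<^sup>2 / 2 + 3 * d\<^sub>y\<^sup>2 + 4 * ?D * d\<^sub>y"
  let ?E = "measure_pmf.expectation (grouped_permutation K G) (\<lambda>\<pi>. \<Sum>t=1..T. reward (\<omega> \<pi> t))"
  let ?W = "unevenness m \<eta> T K G"
  let ?S = "\<Sum>k=1..K. sqrt (real (card (G k)))"
  let ?e = "?W + sqrt (real m * max 1 (ln (real m))) * ?S"
  assume gr: "grouping T K G" and ne: "feasible_values T \<Psi> Z \<noteq> {}"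
    and rest: "m \<ge> 1" "T \<ge> 1" "motzkin_decomposition m \<Psi> Q C"
      "\<forall>t\<in>{1..T}. decision_set n m (Z t)"
      "\<forall>t\<in>{1..T}. regular m \<Psi> Q d\<^sub>y d\<^sub>r d\<^sub>l (Z t)"
      "\<forall>t\<in>{1..T}. \<eta> t = min (1 / real m) (1 / sqrt (real m * real t))"
      "\<forall>\<pi>\<in>set_pmf (grouped_permutation K G).
        primal_dual_run T m Q C \<eta> (\<lambda>t. Z (\<pi> t)) (\<omega> \<pi>) (v \<pi>) (p \<pi>)"
      "online T Z (set_pmf (grouped_permutation K G)) \<omega> v"
  interpret grouped T K G using gr by unfold_locales
  interpret random_order T K G m n \<Psi> Q C d\<^sub>y d\<^sub>r d\<^sub>l \<eta> Z \<omega> v p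
    using rest assms by unfold_locales (auto simp: scenarios_def)
  have "0 \<le> ?M" using D_nonneg assms by (intro add_nonneg_nonneg) auto
  \<comment> \<open>The factor \<open>max 1 (ln (real m))\<close> is at least 1, so the bound
    without a logarithm implies the stated one.\<close>
  moreover have "sqrt (real m) * ?S \<le> sqrt (real m * max 1 (ln (real m))) * ?S"
    using mult_left_mono[of 1 "max 1 (ln (real m))" "real m"]
    by (intro mult_right_mono sum_nonneg real_sqrt_le_mono) auto
  ultimately have le: "?M * (?W + sqrt (real m) * ?S) \<le> ?M * ?e"
    by (intro mult_left_mono) auto
  have "z_R T \<Psi> Z \<le> ?E + ?M * ?e"
    unfolding z_R_def
  \<comment> \<open>\<open>z_R\<close> is a supremum, so it is enough to bound the value of each
    feasible solution.\<close>
  proof (rule cSup_least[OF ne])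
    fix r assume "r \<in> feasible_values T \<Psi> Z"
    then obtain a \<psi> where a: "r = (\<Sum>t=1..T. reward (a t))"
      "\<And>t. t \<in> {1..T} \<Longrightarrow> a t \<in> convex hull Z t"
      "\<psi> \<in> \<Psi>" "(\<Sum>t=1..T. impact (a t)) = real T *\<^sub>R \<psi>"
      by (auto simp: feasible_values_def)
    show "r \<le> ?E + ?M * ?e"
      using expected_reward_ge[of a \<psi>, OF a(2-4)] le a(1) by simp
  qed
  then show "?E \<ge> z_R T \<Psi> Z - ?M * ?e" by simp
qed

end
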